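(* Let $u$ be a palindrome with $|u|\geq 2$ that is a factor of $c_\alpha$. (1) Suppose $u = vU_{n,k}\widetilde{v}$ for some $n\geq 1$, where $v$ is a suffix of $v_{n-2}$, $v\neq v_{n-2}$, and $0\leq k\leq d_{n+1}-2$. Then \[ c_\alpha = \Big(\prod_{j=-1}^{n-2} v_j\Big) v^{-1}\, u^{(1)} z_1 u^{(2)} z_2 u^{(3)} z_3\cdots, \] where $\mathbf{z}=z_1z_2z_3\cdots$ is $c_{\alpha_{n,-k}}\{(vU_{n,k-1}\widetilde{v})^{-1},\ \widetilde{v}^{-1}w_n v^{-1}\}$. (2) Suppose $u = v\overline{U}_{n,k}\widetilde{v}$ for some $n\geq 1$, where $v$ is a suffix of $w_{n-1}$, $v\neq w_{n-1}$, and $0\leq k\leq d_{n+1}-1$. Then \[ c_\alpha = \Big(\prod_{j=-1}^{n-3} v_j\Big) v^{-1}\, u^{(1)} z_1 u^{(2)} z_2 u^{(3)} z_3\cdots, \] where $\mathbf{z}=z_1z_2z_3\cdots$ is $c_{\alpha_{n,1-k}}\{(v\overline{U}_{n,k-1}\widetilde{v})^{-1},\ (vU_{n-1,d_n-2}\widetilde{v})^{-1}\}$. Moreover, if $u=a^k$ for some integer $k\in[2,d_1-1]$, then $c_\alpha = u^{(1)}z_1u^{(2)}z_2u^{(3)}z_3\cdots$, where $z_1z_2z_3\cdots$ is $c_{\alpha_{0,-k}}\{(a^{k-1})^{-1}, b\}$.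
   Context: Words are over the alphabet $\{a,b\}$; $\mathcal{A}^*$ is the free monoid, embedded in the free group $\mathcal{F}$ on $\{a,b\}$, so every word $x$ has an inverse $x^{-1}$; set $|x^{-1}|:=-|x|$. $\varepsilon$ is the empty word. For a word $x=x_1\cdots x_m$, $\widetilde{x}=x_m\cdots x_1$ is its reversal; a palindrome is a word with $x=\widetilde{x}$. A factor of an infinite word $\mathbf{x}=x_0x_1\cdots$ occurs at position $p$ if it equals $x_p\cdots x_{p+|u|-1}$. Products $\prod_{j=m}^{M}x_j$ mean $x_mx_{m+1}\cdots x_M$ (empty product $=\varepsilon$). For an irrational $\gamma\in(0,1)$, the characteristic Sturmian word of slope $\gamma$ is $c_\gamma=c_\gamma(0)c_\gamma(1)\cdots$ with $c_\gamma(n)=a$ if $\lfloor (n+2)\gamma\rfloor-\lfloor (n+1)\gamma\rfloor=0$ and $c_\gamma(n)=b$ otherwise. For $\gamma=[0;a_1,a_2,\ldots]$ (continued fraction), $n\in\mathbb{N}$ and integer $k\geq 1-a_{n+1}$, put $\gamma_{n,k}=[0;a_{n+1}+k,a_{n+2},a_{n+3},\ldots]$. For an infinite word $\mathbf{c}$ over $\{a,b\}$ and $x,y\in\mathcal{F}$, $\mathbf{c}\{x,y\}$ is the sequence obtained from $\mathbf{c}$ by replacing each $a$ by $x$ and each $b$ by $y$. Standing assumption: $\alpha=[0;1+d_1,d_2,d_3,\ldots]$ is irrational with all integers $d_i\geq1$ (so for $\alpha$, $a_1=1+d_1$, $a_i=d_i$ for $i\ge2$). Define $s_{-1}=b$,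 $s_0=a$, $s_n=s_{n-1}^{d_n}s_{n-2}$ ($n\geq1$); $c_\alpha=\lim s_n$. Singular words: $w_{-2}=\varepsilon$, $w_{-1}=a$, and for $n\geq0$, $w_n=as_nb^{-1}$ if $n$ is odd, $w_n=bs_na^{-1}$ if $n$ is even. Adjoining singular words: $v_{-2}=\varepsilon$ and for $n\geq -1$, $v_n=as_{n+1}^{d_{n+2}-1}s_nb^{-1}$ if $n$ is odd, $v_n=bs_{n+1}^{d_{n+2}-1}s_na^{-1}$ if $n$ is even. For $n\geq0$ and $0\leq k\leq d_{n+1}-1$: $U_{n,k}=(w_{n-1}v_{n-2})^kw_{n-1}$ and $\overline{U}_{n,k}=(v_{n-2}w_{n-1})^kv_{n-2}$; by convention $U_{n,-1}=(v_{n-2})^{-1}$ and $\overline{U}_{n,-1}=(w_{n-1})^{-1}$. Decomposition notation: for a factor $u$ of $c_\alpha$, a word $P$ and $z_1,z_2,\ldots\in\mathcal{F}$, writing $c_\alpha=P\,u^{(1)}z_1u^{(2)}z_2u^{(3)}z_3\cdots$ means that $c_\alpha$ is the limit of the free-group products $Puz_1uz_2\cdots uz_i$, where $u^{(i)}$ marks the $i$-th occurrence of $u$ in $c_\alpha$; equivalently, the positions at which $u$ occurs in $c_\alpha$ are exactly $p_1<p_2<\cdots$ with $p_1=|P|$ and $p_{i+1}=p_i+|u|+|z_i|$ (a $z_i$ of the form $x^{-1}$ means consecutive occurrences overlap in $x$). *)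

theory Defs
  imports Complex_Main "HOL-Library.Sublist"
begin

text \<open>A signed letter is a pair of a sign and a letter: \<open>(True, x)\<close> stands for \<open>x\<close> and
  \<open>(False, x)\<close> for its inverse. Elements of the free group are the freely reduced words
  over signed letters.\<close>

type_synonym 'a signed = "bool \<times> 'a"

definition flip :: "'a signed \<Rightarrow> 'a signed" where
  "flip p = (\<not> fst p, snd p)"

fun push :: "'a signed \<Rightarrow> 'a signed list \<Rightarrow> 'a signed list" where
  "push p [] = [p]"
| "push p (q # xs) = (if q = flip p then xs else p # q # xs)"

definition reduce :: "'a signed list \<Rightarrow> 'a signed list" where
  "reduce xs = foldr push xs []"

fun reduced :: "'a signed list \<Rightarrow> bool" where
  "reduced [] = True"
| "reduced [p] = True"
| "reduced (p # q # xs) = (q \<noteq> flip p \<and> reduced (q # xs))"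

lemma flip_flip [simp]: "flip (flip p) = p"
  by (simp add: flip_def)

lemma reduced_tl: "reduced (p # xs) \<Longrightarrow> reduced xs"
  by (cases xs) auto

lemma reduced_push: "reduced xs \<Longrightarrow> reduced (push p xs)"
  by (cases xs) (auto dest: reduced_tl)

lemma reduced_foldr_push: "reduced ys \<Longrightarrow> reduced (foldr push xs ys)"
  by (induction xs) (auto intro: reduced_push)

lemma reduced_reduce [simp]: "reduced (reduce xs)"
  by (simp add: reduce_def reduced_foldr_push)

lemma reduce_id: "reduced xs \<Longrightarrow> reduce xs = xs"
proof (induction xs rule: reduced.induct)
  case (3 p q xs)
  then show ?case by (simp add: reduce_def)
qed (simp_all add: reduce_def)

lemma push_push_flip:
  assumes "reduced ys"
  shows "push p (push (flip p) ys) = ys"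
proof (cases ys)
  case (Cons q zs)
  then show ?thesis using assms by (cases zs) auto
qed simp

lemma foldr_push_push:
  assumes "reduced ys"
  shows "foldr push (push p xs) ys = push p (foldr push xs ys)"
proof (cases xs)
  case (Cons q zs)
  then show ?thesis
    using push_push_flip[OF reduced_foldr_push[OF assms], of p zs] by auto
qed simp

lemma foldr_push_reduce:
  assumes "reduced ys"
  shows "foldr push (reduce xs) ys = foldr push xs ys"
  by (induction xs) (simp_all add: reduce_def foldr_push_push[OF assms])

lemma reduce_append: "reduce (xs @ ys) = foldr push xs (reduce ys)"
  by (simp add: reduce_def)

lemma reduce_append_reduce1: "reduce (reduce xs @ ys) = reduce (xs @ ys)"
  by (simp add: reduce_append foldr_push_reduce)

lemma reduce_append_reduce2: "reduce (xs @ reduce ys) = reduce (xs @ ys)"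
  by (simp add: reduce_append reduce_id)

lemma reduce_map_flip_rev: "reduce (map flip (rev xs) @ xs) = []"
proof (induction xs)
  case (Cons p xs)
  have "reduce (map flip (rev (p # xs)) @ p # xs) = reduce (map flip (rev xs) @ reduce ([flip p, p] @ xs))"
    by (simp add: reduce_append_reduce2)
  also have "reduce ([flip p, p] @ xs) = reduce xs"
    using push_push_flip[of "reduce xs" "flip p"] by (simp only: reduce_append) simp
  also have "reduce (map flip (rev xs) @ reduce xs) = []"
    by (simp add: reduce_append_reduce2 Cons.IH)
  finally show ?case .
qed (simp add: reduce_def)

typedef 'a freegroup = "{xs :: 'a signed list. reduced xs}"
  by (rule exI[of _ "[]"]) simp

setup_lifting type_definition_freegroup

instantiation freegroup :: (type) "{monoid_mult, inverse}"
begin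

lift_definition one_freegroup :: "'a freegroup" is "[]" by simp

lift_definition times_freegroup :: "'a freegroup \<Rightarrow> 'a freegroup \<Rightarrow> 'a freegroup"
  is "\<lambda>xs ys. reduce (xs @ ys)" by simp

lift_definition inverse_freegroup :: "'a freegroup \<Rightarrow> 'a freegroup"
  is "\<lambda>xs. reduce (map flip (rev xs))" by simp

definition divide_freegroup :: "'a freegroup \<Rightarrow> 'a freegroup \<Rightarrow> 'a freegroup" where
  "divide_freegroup x y = x * inverse y"

instance
proof
  fix x y z :: "'a freegroup"
  show "x * y * z = x * (y * z)"
    by transfer (simp add: reduce_append_reduce1 reduce_append_reduce2)
  show "1 * x = x" "x * 1 = x"
    by (transfer, simp add: reduce_id)+
qed

end

lemma freegroup_left_inverse: "inverse x * x = (1 :: 'a freegroup)"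
  by transfer (simp add: reduce_append_reduce1 reduce_map_flip_rev)

lift_definition word :: "'a list \<Rightarrow> 'a freegroup" is "map (Pair True)"
proof -
  fix xs :: "'a list"
  show "reduced (map (Pair True) xs)"
  proof (induction xs)
    case (Cons x xs)
    then show ?case by (cases xs) (auto simp: flip_def)
  qed simp
qed

lemma word_inj: "word xs = word ys \<longleftrightarrow> xs = ys"
  by transfer (simp add: inj_map_eq_map inj_on_def)

datatype letter = La | Lb

type_synonym F = "letter freegroup"

definition occurs_at :: "(nat \<Rightarrow> 'a) \<Rightarrow> 'a list \<Rightarrow> nat \<Rightarrow> bool" where
  "occurs_at x u p \<longleftrightarrow> u = map x [p..<p + length u]"

definition is_factor :: "'a list \<Rightarrow> (nat \<Rightarrow> 'a) \<Rightarrow> bool" where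
  "is_factor u x \<longleftrightarrow> (\<exists>p. occurs_at x u p)"

definition palindrome :: "'a list \<Rightarrow> bool" where
  "palindrome u \<longleftrightarrow> rev u = u"

definition char_word :: "real \<Rightarrow> nat \<Rightarrow> letter" where
  "char_word \<gamma> n =
    (if \<lfloor>real (n + 2) * \<gamma>\<rfloor> - \<lfloor>real (n + 1) * \<gamma>\<rfloor> = 0 then La else Lb)"

text \<open>The sequence \<open>c{x, y}\<close>. It is a sequence of free group elements, so that its terms
  are the factors \<open>z\<^sub>1, z\<^sub>2, \<dots>\<close> and not their letters.\<close>

definition subst_word :: "(nat \<Rightarrow> letter) \<Rightarrow> F \<Rightarrow> F \<Rightarrow> nat \<Rightarrow> F" where
  "subst_word c x y n = (case c n of La \<Rightarrow> x | Lb \<Rightarrow> y)"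

text \<open>The decomposition \<open>c = P u\<^sup>(\<^sup>1\<^sup>) z\<^sub>1 u\<^sup>(\<^sup>2\<^sup>) z\<^sub>2 \<dots>\<close>. Sequences are indexed from 0, so \<open>z i\<close> and
  \<open>p i\<close> are \<open>z\<^sub>i\<^sub>+\<^sub>1\<close> and \<open>p\<^sub>i\<^sub>+\<^sub>1\<close>. The occurrences of \<open>u\<close> are exactly at \<open>p 0 < p 1 < \<dots>\<close>, and the
  free group product \<open>P u z\<^sub>1 \<dots> u z\<^sub>i\<close> in front of the next occurrence is the prefix of
  \<open>c\<close> of length \<open>p i\<close>; hence these products tend to \<open>c\<close>, and taking (signed) lengths gives
  \<open>p\<^sub>1 = |P|\<close> and \<open>p\<^sub>i\<^sub>+\<^sub>1 = p\<^sub>i + |u| + |z\<^sub>i|\<close>.\<close>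

definition decomposition ::
  "(nat \<Rightarrow> letter) \<Rightarrow> F \<Rightarrow> letter list \<Rightarrow> (nat \<Rightarrow> F) \<Rightarrow> bool" where
  "decomposition c P u z \<longleftrightarrow>
    (\<exists>p :: nat \<Rightarrow> nat. strict_mono p \<and> range p = {q. occurs_at c u q} \<and>
      (\<forall>i. P * prod_list (map (\<lambda>j. word u * z j) [0..<i]) = word (map c [0..<p i])))"

text \<open>\<open>cf_convergent a n = [0; a 1, \<dots>, a n]\<close>; the value \<open>a 0\<close> is never used.
  For positive partial quotients the convergents converge, so \<open>lim\<close> in \<open>cf_value\<close> is the
  value of the infinite continued fraction.\<close>

fun cf_convergent :: "(nat \<Rightarrow> int) \<Rightarrow> nat \<Rightarrow> real" where
  "cf_convergent a 0 = 0"
| "cf_convergent a (Suc n) = 1 / (real_of_int (a 1) + cf_convergent (\<lambda>i. a (Suc i)) n)"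

definition cf_value :: "(nat \<Rightarrow> int) \<Rightarrow> real" where
  "cf_value a = lim (cf_convergent a)"

text \<open>\<open>cf_shift a n k = [0; a (n + 1) + k, a (n + 2), a (n + 3), \<dots>]\<close>, i.e. \<open>\<gamma>\<^sub>n\<^sub>,\<^sub>k\<close> for
  \<open>\<gamma> = [0; a 1, a 2, \<dots>]\<close>.\<close>

definition cf_shift :: "(nat \<Rightarrow> int) \<Rightarrow> nat \<Rightarrow> int \<Rightarrow> real" where
  "cf_shift a n k = cf_value (\<lambda>i. if i = 1 then a (n + 1) + k else a (n + i))"

text \<open>The partial quotients of \<open>\<alpha> = [0; 1 + d 1, d 2, d 3, \<dots>]\<close>.\<close>

definition quotients :: "(nat \<Rightarrow> nat) \<Rightarrow> nat \<Rightarrow> int" where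
  "quotients d i = (if i = 1 then 1 + int (d 1) else int (d i))"

abbreviation ga :: F where "ga \<equiv> word [La]"
abbreviation gb :: F where "gb \<equiv> word [Lb]"

text \<open>\<open>std d n = s\<^sub>n\<close>, \<open>sing d n = w\<^sub>n\<close> and \<open>adj d n = v\<^sub>n\<close>, all as elements of the free group.
  The recursion \<open>std_from\<close> runs over \<open>n + 1\<close>, because \<open>n\<close> starts at \<open>-1\<close>.\<close>

fun std_from :: "(nat \<Rightarrow> nat) \<Rightarrow> nat \<Rightarrow> F" where
  "std_from d 0 = gb"
| "std_from d (Suc 0) = ga"
| "std_from d (Suc (Suc m)) = std_from d (Suc m) ^ d (Suc m) * std_from d m"

definition std :: "(nat \<Rightarrow> nat) \<Rightarrow> int \<Rightarrow> F" where
  "std d n = std_from d (nat (n + 1))"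

definition sing :: "(nat \<Rightarrow> nat) \<Rightarrow> int \<Rightarrow> F" where
  "sing d n =
    (if n = -2 then 1
     else if n = -1 then ga
     else if odd n then ga * std d n * inverse gb
     else gb * std d n * inverse ga)"

definition adj :: "(nat \<Rightarrow> nat) \<Rightarrow> int \<Rightarrow> F" where
  "adj d n =
    (if n = -2 then 1
     else if odd n then ga * std d (n + 1) ^ (d (nat (n + 2)) - 1) * std d n * inverse gb
     else gb * std d (n + 1) ^ (d (nat (n + 2)) - 1) * std d n * inverse ga)"

definition Uw :: "(nat \<Rightarrow> nat) \<Rightarrow> nat \<Rightarrow> int \<Rightarrow> F" where
  "Uw d n k =
    (if k = -1 then inverse (adj d (int n - 2))
     else (sing d (int n - 1) * adj d (int n - 2)) ^ nat k * sing d (int n - 1))"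

definition Ubarw :: "(nat \<Rightarrow> nat) \<Rightarrow> nat \<Rightarrow> int \<Rightarrow> F" where
  "Ubarw d n k =
    (if k = -1 then inverse (sing d (int n - 1))
     else (adj d (int n - 2) * sing d (int n - 1)) ^ nat k * adj d (int n - 2))"

text \<open>\<open>v\<close> is a suffix of the word \<open>x\<close> and \<open>v \<noteq> x\<close>, for a word \<open>x\<close> given as an element of
  the free group.\<close>

definition proper_suffix_of :: "letter list \<Rightarrow> F \<Rightarrow> bool" where
  "proper_suffix_of v x \<longleftrightarrow> (\<exists>y. x = word y \<and> strict_suffix v y)"

end

theory Submission
  imports Defs
begin

text \<open>
  Let \<open>c\<^sub>n\<close> be the characteristic word of \<open>[0; 1 + d\<^sub>n\<^sub>+\<^sub>1, d\<^sub>n\<^sub>+\<^sub>2, \<dots>]\<close>. Then \<open>c\<^sub>\<alpha>\<close> is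
  the image of \<open>c\<^sub>n\<close> under \<open>a \<mapsto> s\<^sub>n\<close>, \<open>b \<mapsto> s\<^sub>n\<^sub>-\<^sub>1\<close>, and \<open>c\<^sub>n\<close> is the image of \<open>c\<^sub>\<gamma>\<close>
  under \<open>a \<mapsto> a\<close>, \<open>b \<mapsto> a\<^sup>m b\<close>, where \<open>\<gamma>\<close> arises by lowering the first partial quotient by
  \<open>m\<close>; the powers \<open>a\<^sup>m\<close> occur in \<open>c\<^sub>n\<close> exactly at the block starts of the latter image.
  If \<open>x\<close> and \<open>y\<close> are the last letters of \<open>s\<^sub>n\<close> and \<open>s\<^sub>n\<^sub>-\<^sub>1\<close>, then \<open>U\<^sub>n\<^sub>,\<^sub>k = x s\<^sub>n\<^sup>k
  s\<^sub>n\<^sub>-\<^sub>1 y\<inverse>\<close>, and by desubstitution its occurrences in \<open>c\<^sub>\<alpha>\<close> are those of \<open>a\<^sup>k\<^sup>+\<^sup>1\<close> in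
  \<open>c\<^sub>n\<close>, shifted by \<open>|s\<^sub>n| - 1\<close>. The other family reduces to the first one, one level
  below, with \<open>a\<^sup>k\<^sup>+\<^sup>1\<close> replaced by the image of \<open>a\<^sup>k\<close> followed by \<open>a\<close> to the power
  \<open>d\<^sub>n\<close>. Since \<open>v\<^sub>-\<^sub>1 \<cdots> v\<^sub>n\<^sub>-\<^sub>2 = s\<^sub>n x\<inverse>\<close>, conjugation by the prefix \<open>P\<close> of the
  decomposition turns the products \<open>u z\<^sub>i\<close> into the blocks \<open>s\<^sub>n\<close> and \<open>s\<^sub>n\<^sup>k\<^sup>+\<^sup>1 s\<^sub>n\<^sub>-\<^sub>1\<close>
  (respectively \<open>s\<^sub>n\<^sup>k s\<^sub>n\<^sub>-\<^sub>1\<close>), whatever \<open>v\<close> is.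
\<close>

section \<open>Occurrences and images under morphisms\<close>

lemma occurs_at_Nil [simp]: "occurs_at c [] p"
  by (simp add: occurs_at_def)

lemma occurs_at_Cons: "occurs_at c (x # w) p \<longleftrightarrow> c p = x \<and> occurs_at c w (Suc p)"
proof -
  have "[p..<p + length (x # w)] = p # [Suc p..<Suc p + length w]"
    by (simp add: upt_conv_Cons del: upt_Suc)
  then show ?thesis
    by (auto simp only: occurs_at_def list.map list.inject)
qed

lemma occurs_at_append:
  "occurs_at c (u @ w) p \<longleftrightarrow> occurs_at c u p \<and> occurs_at c w (p + length u)"
  by (induction u arbitrary: p) (auto simp: occurs_at_Cons)

lemma occurs_at_inj: "occurs_at c u p \<Longrightarrow> occurs_at c w p \<Longrightarrow> length u = length w \<Longrightarrow> u = w"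
  by (simp add: occurs_at_def)

lemma occurs_at_prefix:
  assumes "occurs_at c u p" "occurs_at c w p" "length u \<le> length w"
  shows "\<exists>r. w = u @ r"
proof -
  have "occurs_at c (take (length u) w @ drop (length u) w) p"
    using assms(2) by simp
  then have "occurs_at c (take (length u) w) p"
    unfolding occurs_at_append by blast
  then have "u = take (length u) w"
    using assms(1,3) by (intro occurs_at_inj) auto
  then show ?thesis
    by (metis append_take_drop_id)
qed

lemma occurs_at_replicate: "occurs_at c (replicate m x) p \<longleftrightarrow> (\<forall>i<m. c (p + i) = x)"
proof (induction m arbitrary: p)
  case (Suc m)
  show ?case
    by (auto simp: occurs_at_Cons Suc less_Suc_eq_0_disj)
qed simp

abbreviation morph :: "('a \<Rightarrow> 'b list) \<Rightarrow> 'a list \<Rightarrow> 'b list" where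
  "morph h w \<equiv> concat (map h w)"

lemma morph_morph: "morph h (morph g w) = morph (\<lambda>x. morph h (g x)) w"
  by (induction w) auto

lemma morph_replicate_eq: "h x = [y] \<Longrightarrow> morph h (replicate m x) = replicate m y"
  by (induction m) auto

definition start :: "('a \<Rightarrow> 'b list) \<Rightarrow> (nat \<Rightarrow> 'a) \<Rightarrow> nat \<Rightarrow> nat" where
  "start h c i = length (morph h (map c [0..<i]))"

lemma start_0 [simp]: "start h c 0 = 0"
  by (simp add: start_def)

lemma start_Suc [simp]: "start h c (Suc i) = start h c i + length (h (c i))"
  by (simp add: start_def)

text \<open>Stating where each block is read avoids constructing the infinite image. For a
  nonerasing \<open>h\<close> the blocks cover all positions, so \<open>c\<close> is determined by
  \<open>h\<close> and \<open>c'\<close>.\<close>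

definition is_image :: "(nat \<Rightarrow> 'b) \<Rightarrow> ('a \<Rightarrow> 'b list) \<Rightarrow> (nat \<Rightarrow> 'a) \<Rightarrow> bool" where
  "is_image c h c' \<longleftrightarrow> (\<forall>i. occurs_at c (h (c' i)) (start h c' i))"

lemma image_occurs:
  assumes "is_image c h c'" "occurs_at c' w j"
  shows "occurs_at c (morph h w) (start h c' j)"
    and "start h c' (j + length w) = start h c' j + length (morph h w)"
  using assms(2)
proof (induction w arbitrary: j)
  case (Cons x w)
  {
    case 1
    then have "c' j = x" "occurs_at c' w (Suc j)"
      by (auto simp: occurs_at_Cons)
    with Cons(1)[of "Suc j"] assms(1) show ?case
      by (auto simp: occurs_at_append is_image_def)
  next
    case 2
    then have "c' j = x" "occurs_at c' w (Suc j)"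
      by (auto simp: occurs_at_Cons)
    with Cons(2)[of "Suc j"] show ?case
      by simp
  }
qed simp_all

lemma image_prefix:
  assumes "is_image c h c'"
  shows "map c [0..<start h c' i] = morph h (map c' [0..<i])"
proof -
  have "occurs_at c' (map c' [0..<i]) 0"
    by (simp add: occurs_at_def)
  from image_occurs(1)[OF assms this] show ?thesis
    by (simp add: occurs_at_def start_def)
qed

lemma start_comp:
  assumes "is_image c' g c''"
  shows "start (\<lambda>x. morph h (g x)) c'' i = start h c' (start g c'' i)"
proof (induction i)
  case (Suc i)
  have "occurs_at c' (g (c'' i)) (start g c'' i)"
    using assms by (simp add: is_image_def)
  then have "map c' [0..<start g c'' (Suc i)] = map c' [0..<start g c'' i] @ g (c'' i)"
    by (simp add: occurs_at_def upt_add_eq_append[of 0 "start g c'' i", OF le0])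
  then show ?case
    using Suc by (simp add: start_def[of h c'] del: start_Suc) simp
qed simp

lemma is_image_comp:
  assumes "is_image c h c'" "is_image c' g c''"
  shows "is_image c (\<lambda>x. morph h (g x)) c''"
  unfolding is_image_def start_comp[OF assms(2)]
  using image_occurs(1)[OF assms(1)] assms(2) by (auto simp: is_image_def)

lemma start_strict_mono:
  assumes "\<And>x. h x \<noteq> []"
  shows "strict_mono (start h c)"
  by (rule strict_mono_Suc_iff[THEN iffD2]) (simp add: assms)

lemma start_cover:
  assumes "\<And>x. h x \<noteq> []"
  obtains i r where "q = start h c i + r" "r < length (h (c i))"
proof -
  have "\<exists>i r. q = start h c i + r \<and> r < length (h (c i))"
  proof (induction q)
    case 0
    show ?case
      using assms[of "c 0"] by (intro exI[of _ 0]) auto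
  next
    case (Suc q)
    then obtain i r where q: "q = start h c i + r" "r < length (h (c i))"
      by auto
    show ?case
    proof (cases "Suc r < length (h (c i))")
      case True
      then show ?thesis
        using q by (intro exI[of _ i] exI[of _ "Suc r"]) simp
    next
      case False
      then show ?thesis
        using q assms[of "c (Suc i)"] by (intro exI[of _ "Suc i"] exI[of _ 0]) simp
    qed
  qed
  with that show ?thesis
    by blast
qed

section \<open>Block boundaries of the morphism \<open>run m\<close>\<close>

fun run :: "nat \<Rightarrow> letter \<Rightarrow> letter list" where
  "run m La = [La]"
| "run m Lb = replicate m La @ [Lb]"

lemma run_nonempty [simp]: "run m x \<noteq> []"
  by (cases x) auto

lemma run_starts:
  assumes "is_image c (run m) c'"
  shows "occurs_at c (replicate m La) (start (run m) c' i)"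
proof -
  \<comment> \<open>The exponent varies because a block \<open>a\<close> supplies one letter and
    asks only \<open>r - 1\<close> more of the next block, whereas a block \<open>a^m b\<close>
    supplies up to \<open>m\<close> at once.\<close>
  have "occurs_at c (replicate r La) (start (run m) c' i)" if "r \<le> m" for r
    using that
  proof (induction r arbitrary: i)
    case (Suc r)
    have blk: "occurs_at c (run m (c' i)) (start (run m) c' i)"
      using assms by (simp add: is_image_def)
    show ?case
    proof (cases "c' i")
      case La
      then show ?thesis
        using blk Suc.IH[of "Suc i"] Suc.prems by (simp add: occurs_at_Cons)
    next
      case Lb
      then show ?thesis
        using blk Suc.prems
        by (auto simp: occurs_at_append occurs_at_replicate simp del: replicate_Suc)
    qed
  qed simp
  then show ?thesis
    by blast
qed

text \<open>A block \<open>a\<close> has no inner positions, and a power \<open>a^m\<close>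
  beginning inside a block \<open>a^m b\<close> would run over its final \<open>b\<close>.\<close>

lemma occurs_run_power_iff:
  assumes "is_image c (run m) c'"
  shows "occurs_at c (replicate m La) q \<longleftrightarrow> (\<exists>i. q = start (run m) c' i)"
proof
  assume q: "occurs_at c (replicate m La) q"
  obtain i r where i: "q = start (run m) c' i + r" "r < length (run m (c' i))"
    using start_cover[of "run m"] by (metis run_nonempty)
  have blk: "occurs_at c (run m (c' i)) (start (run m) c' i)"
    using assms by (simp add: is_image_def)
  have "r = 0"
  proof (rule ccontr)
    assume "r \<noteq> 0"
    with i(2) have b: "c' i = Lb" and r: "0 < r" "r \<le> m"
      by (cases "c' i"; simp)+
    have "c (start (run m) c' i + m) = Lb"
      using blk b by (simp add: occurs_at_append occurs_at_Cons)
    moreover have "c (q + (m - r)) = La"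
      using q[unfolded occurs_at_replicate, rule_format, of "m - r"] r by simp
    ultimately show False
      using i(1) r by simp
  qed
  with i show "\<exists>i. q = start (run m) c' i"
    by auto
next
  assume "\<exists>i. q = start (run m) c' i"
  with run_starts[OF assms] show "occurs_at c (replicate m La) q"
    by blast
qed

lemma run_power_prefix: "\<exists>r. morph (run m) w @ replicate m La = replicate m La @ r"
proof (induction w)
  case (Cons x w)
  show ?case
  proof (cases x)
    case La
    obtain r where "morph (run m) w @ replicate m La = replicate m La @ r"
      using Cons by blast
    with La have "morph (run m) (x # w) @ replicate m La = replicate m La @ La # r"
      by (simp add: replicate_app_Cons_same)
    then show ?thesis
      by blast
  next
    case Lb
    then show ?thesis
      by (intro exI[of _ "Lb # morph (run m) w @ replicate m La"]) simp
  qed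
qed simp

text \<open>Blocks are recognisable because each is followed by \<open>a^m\<close>: the letter
  \<open>m\<close> places after the start of the block of \<open>y\<close> is \<open>y\<close>,
  since \<open>a^(m+1)\<close> is read there for \<open>y = a\<close> and \<open>a^m b\<close> for
  \<open>y = b\<close>. The trailing \<open>a^m\<close> provides this also for the last block of the
  word.\<close>

lemma occurs_run_iff:
  assumes "is_image c (run m) c'"
  shows "occurs_at c (morph (run m) w @ replicate m La) q \<longleftrightarrow>
    (\<exists>j. q = start (run m) c' j \<and> occurs_at c' w j)"
proof
  assume "\<exists>j. q = start (run m) c' j \<and> occurs_at c' w j"
  then obtain j where j: "q = start (run m) c' j" "occurs_at c' w j"
    by blast
  with image_occurs[OF assms j(2)] run_starts[OF assms, of "j + length w"]
  show "occurs_at c (morph (run m) w @ replicate m La) q"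
    by (auto simp: occurs_at_append)
next
  assume "occurs_at c (morph (run m) w @ replicate m La) q"
  then show "\<exists>j. q = start (run m) c' j \<and> occurs_at c' w j"
  proof (induction w arbitrary: q)
    case Nil
    then show ?case
      using occurs_run_power_iff[OF assms] by simp
  next
    case (Cons x w)
    let ?s = "start (run m) c'"
    have rest: "occurs_at c (run m x) q"
      "occurs_at c (morph (run m) w @ replicate m La) (q + length (run m x))"
      using Cons.prems by (auto simp: occurs_at_append add.assoc)
    from Cons.IH[OF rest(2)] obtain j' where
      j': "q + length (run m x) = ?s j'" "occurs_at c' w j'"
      by blast
    have "occurs_at c (replicate m La) q"
      using Cons.prems run_power_prefix[of m "x # w"] by (metis occurs_at_append)
    then obtain j where j: "q = ?s j"
      using occurs_run_power_iff[OF assms] by blast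
    have blk: "occurs_at c (run m (c' j)) q"
      using assms j by (simp add: is_image_def)
    have next': "occurs_at c (replicate m La) (q + length (run m y))"
      if "y = x \<or> y = c' j" for y
      using that
    proof
      assume "y = x"
      then show ?thesis
        using run_starts[OF assms] j'(1) by simp
    next
      assume "y = c' j"
      then show ?thesis
        using run_starts[OF assms, of "Suc j"] j by simp
    qed
    \<comment> \<open>Taken for the letter of the word and for the letter of \<open>c'\<close>, this
      reads the same position twice and so identifies the two.\<close>
    have at: "c (q + m) = y" if "y = x \<or> y = c' j" for y
    proof (cases y)
      case La
      have "occurs_at c [La] q"
        using that rest(1) blk La by auto
      then have "occurs_at c (replicate (Suc m) La) q"
        using next'[OF that] La by (simp add: occurs_at_Cons)
      then show ?thesis
        unfolding occurs_at_replicate using La by blast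
    next
      case Lb
      have "occurs_at c (replicate m La @ [Lb]) q"
        using that rest(1) blk Lb by auto
      then show ?thesis
        using Lb by (simp add: occurs_at_append occurs_at_Cons)
    qed
    have "c' j = x"
      using at[of x] at[of "c' j"] by simp
    moreover have "j' = Suc j"
    proof -
      have "?s j' = ?s (Suc j)"
        using j' j \<open>c' j = x\<close> by simp
      then show ?thesis
        using start_strict_mono[of "run m" c'] by (metis run_nonempty strict_mono_eq)
    qed
    ultimately show ?case
      using j j' by (intro exI[of _ j]) (simp add: occurs_at_Cons)
  qed
qed

lemma run_Lb_position:
  assumes "is_image c (run m) c'" "c q = Lb"
  obtains i where "q = start (run m) c' i + m" "c' i = Lb"
proof -
  obtain i r where i: "q = start (run m) c' i + r" "r < length (run m (c' i))"
    using start_cover[of "run m"] by (metis run_nonempty)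
  have blk: "occurs_at c (run m (c' i)) (start (run m) c' i)"
    using assms by (simp add: is_image_def)
  show thesis
  proof (cases "c' i")
    case La
    then show ?thesis
      using blk i assms(2) by (simp add: occurs_at_Cons)
  next
    case Lb
    then have "r \<ge> m"
      using blk i assms(2) letter.distinct
      by (metis linorder_not_le occurs_at_append occurs_at_replicate run.simps(2))
    with i Lb have "r = m"
      by simp
    with that i Lb show ?thesis
      by blast
  qed
qed

text \<open>The missing flanking powers are recovered: every \<open>b\<close> ends a block
  \<open>a^m b\<close>, which completes the front, and the word itself ends in \<open>b\<close>, so
  a new block starts behind it and brings \<open>a^m\<close>.\<close>

lemma occurs_run_Lb_iff:
  assumes "is_image c (run m) c'" and "w = [] \<or> last w = Lb"
  shows "occurs_at c (Lb # morph (run m) w) q \<longleftrightarrow>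
    (\<exists>j. q = start (run m) c' j + m \<and> occurs_at c' (Lb # w) j)"
proof
  assume "\<exists>j. q = start (run m) c' j + m \<and> occurs_at c' (Lb # w) j"
  then obtain j where j: "q = start (run m) c' j + m" "occurs_at c' (Lb # w) j"
    by blast
  with image_occurs(1)[OF assms(1) j(2)]
  show "occurs_at c (Lb # morph (run m) w) q"
    by (simp add: occurs_at_append)
next
  assume q: "occurs_at c (Lb # morph (run m) w) q"
  let ?s = "start (run m) c'"
  obtain i where i: "q = ?s i + m" "c' i = Lb"
    using run_Lb_position[OF assms(1)] q by (auto simp: occurs_at_Cons)
  have "occurs_at c (run m (c' i)) (?s i)"
    using assms by (simp add: is_image_def)
  then have w: "occurs_at c (morph (run m) (Lb # w)) (?s i)"
    using q i by (simp add: occurs_at_append occurs_at_Cons)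
  obtain z where z: "morph (run m) (Lb # w) = z @ [Lb]"
  proof (cases w rule: rev_cases)
    case (snoc w' y)
    then show ?thesis
      using assms(2) that[of "morph (run m) (Lb # w') @ replicate m La"] by simp
  qed (use that in simp)
  then have "c (?s i + length z) = Lb"
    using w by (simp add: occurs_at_append occurs_at_Cons)
  then obtain i' where i': "?s i + length z = ?s i' + m" "c' i' = Lb"
    using run_Lb_position[OF assms(1)] by blast
  then have "?s i + length (morph (run m) (Lb # w)) = ?s (Suc i')"
    unfolding z by simp
  then have "occurs_at c (morph (run m) (Lb # w) @ replicate m La) (?s i)"
    using w run_starts[OF assms(1), of "Suc i'"] by (simp only: occurs_at_append)
  then obtain j where "?s i = ?s j" "occurs_at c' (Lb # w) j"
    using occurs_run_iff[OF assms(1)] by blast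
  with i show "\<exists>j. q = ?s j + m \<and> occurs_at c' (Lb # w) j"
    by metis
qed

section \<open>Continued fractions and characteristic words\<close>

lemma cf_convergent_cong:
  "(\<And>i. i \<ge> 1 \<Longrightarrow> a i = b i) \<Longrightarrow> cf_convergent a n = cf_convergent b n"
proof (induction n arbitrary: a b)
  case (Suc n)
  have "cf_convergent (\<lambda>i. a (Suc i)) n = cf_convergent (\<lambda>i. b (Suc i)) n"
    by (rule Suc.IH) (simp add: Suc.prems)
  then show ?case
    by (simp add: Suc.prems)
qed simp

lemma cf_value_cong: "(\<And>i. i \<ge> 1 \<Longrightarrow> a i = b i) \<Longrightarrow> cf_value a = cf_value b"
  unfolding cf_value_def by (rule arg_cong[where f = lim], rule ext, rule cf_convergent_cong)

lemma cf_convergent_bounds: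
  assumes "\<And>i. i \<ge> 1 \<Longrightarrow> a i \<ge> 1"
  shows "0 \<le> cf_convergent a n \<and> cf_convergent a n \<le> 1"
  using assms
proof (induction n arbitrary: a)
  case (Suc n)
  have "0 \<le> cf_convergent (\<lambda>i. a (Suc i)) n"
    using Suc.IH[of "\<lambda>i. a (Suc i)"] Suc.prems by simp
  moreover have "real_of_int (a 1) \<ge> 1"
    using Suc.prems[of 1] by linarith
  ultimately show ?case
    by (auto simp: divide_simps)
qed simp

text \<open>One step \<open>1 / (p + x)\<close> need not contract, having derivative -1 at
  \<open>x = 0\<close> for \<open>p = 1\<close>. Two steps form a Moebius map of determinant 1 whose
  denominators are at least 2, hence the factor 1/4.\<close>

lemma cf_two_steps_contract:
  fixes p q x y :: real
  assumes "p \<ge> 1" "q \<ge> 1" "x \<ge> 0" "y \<ge> 0"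
  shows "\<bar>1 / (p + 1 / (q + x)) - 1 / (p + 1 / (q + y))\<bar> \<le> \<bar>x - y\<bar> / 4"
proof -
  let ?D = "\<lambda>t. p * (q + t) + 1"
  have D: "?D t \<ge> 2" if "t \<ge> 0" for t
  proof -
    have "1 * 1 \<le> p * (q + t)"
      using assms that by (intro mult_mono) auto
    then show ?thesis
      by simp
  qed
  have eq: "1 / (p + 1 / (q + t)) = (q + t) / ?D t" if "t \<ge> 0" for t
    using assms that by (simp add: divide_simps)
  have "(q + x) / ?D x - (q + y) / ?D y = (x - y) / (?D x * ?D y)"
    using D[OF assms(3)] D[OF assms(4)] by (simp add: divide_simps algebra_simps)
  moreover have "4 \<le> ?D x * ?D y"
    using mult_mono[of 2 "?D x" 2 "?D y"] D[OF assms(3)] D[OF assms(4)] by simp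
  then have "\<bar>(x - y) / (?D x * ?D y)\<bar> \<le> \<bar>x - y\<bar> / 4"
    unfolding abs_divide by (intro frac_le) simp_all
  ultimately show ?thesis
    using eq[OF assms(3)] eq[OF assms(4)] by simp
qed

lemma cf_convergent_close:
  assumes "\<And>i. i \<ge> 1 \<Longrightarrow> a i \<ge> 1"
  shows "\<bar>cf_convergent a (2 * n + k) - cf_convergent a (2 * n + l)\<bar> \<le> (1 / 4) ^ n"
  using assms
proof (induction n arbitrary: a)
  case 0
  then show ?case
    using cf_convergent_bounds[of a k] cf_convergent_bounds[of a l] by auto
next
  case (Suc n)
  define x where "x m = cf_convergent (\<lambda>i. a (Suc (Suc i))) (2 * n + m)" for m
  have x: "x m \<ge> 0" for m
    unfolding x_def using cf_convergent_bounds Suc.prems by simp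
  have "real_of_int (a 1) \<ge> 1" "real_of_int (a (Suc 1)) \<ge> 1"
    using Suc.prems[of 1] Suc.prems[of "Suc 1"] by linarith+
  from cf_two_steps_contract[OF this x x, of k l]
  have "\<bar>cf_convergent a (2 * Suc n + k) - cf_convergent a (2 * Suc n + l)\<bar> \<le> \<bar>x k - x l\<bar> / 4"
    by (simp add: x_def)
  also have "\<bar>x k - x l\<bar> / 4 \<le> (1 / 4) ^ n / 4"
    unfolding x_def using Suc.IH[of "\<lambda>i. a (Suc (Suc i))"] Suc.prems by simp
  finally show ?case
    by simp
qed

lemma cf_convergent_convergent:
  assumes "\<And>i. i \<ge> 1 \<Longrightarrow> a i \<ge> 1"
  shows "convergent (cf_convergent a)"
proof (rule Cauchy_convergent, rule metric_CauchyI)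
  fix e :: real
  assume "e > 0"
  then obtain n where n: "(1 / 4 :: real) ^ n < e"
    using real_arch_pow_inv[of e "1 / 4"] by auto
  show "\<exists>M. \<forall>m\<ge>M. \<forall>k\<ge>M. dist (cf_convergent a m) (cf_convergent a k) < e"
  proof (intro exI[of _ "2 * n"] allI impI)
    fix m k
    assume "2 * n \<le> m" "2 * n \<le> k"
    then show "dist (cf_convergent a m) (cf_convergent a k) < e"
      using cf_convergent_close[of a n "m - 2 * n" "k - 2 * n"] assms n
      by (simp add: dist_real_def)
  qed
qed

lemma cf_value_LIMSEQ:
  assumes "\<And>i. i \<ge> 1 \<Longrightarrow> a i \<ge> 1"
  shows "cf_convergent a \<longlonglongrightarrow> cf_value a"
  unfolding cf_value_def using cf_convergent_convergent[of a] assms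
  by (simp add: convergent_LIMSEQ_iff)

lemma cf_value_nonneg:
  assumes "\<And>i. i \<ge> 1 \<Longrightarrow> a i \<ge> 1"
  shows "0 \<le> cf_value a"
proof (rule LIMSEQ_le_const)
  show "cf_convergent a \<longlonglongrightarrow> cf_value a"
    using assms by (rule cf_value_LIMSEQ)
  have "0 \<le> cf_convergent a n" for n
    using cf_convergent_bounds[of a n] assms by blast
  then show "\<exists>N. \<forall>n\<ge>N. 0 \<le> cf_convergent a n"
    by blast
qed

lemma cf_value_rec:
  assumes "\<And>i. i \<ge> 1 \<Longrightarrow> a i \<ge> 1"
  shows "cf_value a = 1 / (real_of_int (a 1) + cf_value (\<lambda>i. a (Suc i)))"
proof -
  let ?b = "\<lambda>i. a (Suc i)"
  have b: "?b i \<ge> 1" if "i \<ge> 1" for i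
    using assms[of "Suc i"] by simp
  have "real_of_int (a 1) \<ge> 1"
    using assms[of 1] by linarith
  moreover have "0 \<le> cf_value ?b"
    using b by (rule cf_value_nonneg)
  ultimately have "real_of_int (a 1) + cf_value ?b \<noteq> 0"
    by linarith
  then have "(\<lambda>n. cf_convergent a (Suc n)) \<longlonglongrightarrow> 1 / (real_of_int (a 1) + cf_value ?b)"
    unfolding cf_convergent.simps
    by (intro tendsto_intros cf_value_LIMSEQ b)
  moreover have "(\<lambda>n. cf_convergent a (Suc n)) \<longlonglongrightarrow> cf_value a"
    using cf_value_LIMSEQ[OF assms] by (rule LIMSEQ_Suc)
  ultimately show ?thesis
    by (rule LIMSEQ_unique[symmetric])
qed

lemma cf_value_pos:
  assumes "\<And>i. i \<ge> 1 \<Longrightarrow> a i \<ge> 1"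
  shows "0 < cf_value a"
proof -
  have "real_of_int (a 1) \<ge> 1"
    using assms[of 1] by linarith
  moreover have "0 \<le> cf_value (\<lambda>i. a (Suc i))"
    using assms by (intro cf_value_nonneg) simp
  ultimately show ?thesis
    by (subst cf_value_rec[OF assms]) simp_all
qed

lemma quotients_value:
  fixes d :: "nat \<Rightarrow> nat"
  assumes "\<And>i. i \<ge> 1 \<Longrightarrow> d i \<ge> 1"
  defines "\<xi> \<equiv> cf_value (\<lambda>i. int (d (Suc i)))"
  shows "cf_value (quotients d) = 1 / (1 + real (d 1) + \<xi>)" and "0 < \<xi>"
proof -
  have "quotients d i \<ge> 1" if "i \<ge> 1" for i
    using assms(1)[OF that] by (simp add: quotients_def)
  moreover have "cf_value (\<lambda>i. quotients d (Suc i)) = \<xi>"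
    unfolding \<xi>_def by (rule cf_value_cong) (simp add: quotients_def)
  ultimately show "cf_value (quotients d) = 1 / (1 + real (d 1) + \<xi>)"
    using cf_value_rec[of "quotients d"] by (simp add: quotients_def)
  show "0 < \<xi>"
    unfolding \<xi>_def using assms(1)[of "Suc _"] by (intro cf_value_pos) simp
qed

text \<open>\<open>F i\<close> counts the letters \<open>b\<close> among the first \<open>i\<close>,
  so block \<open>i\<close> starts at \<open>q = i + F i\<close>. Adding \<open>F i\<close> to the
  bounds \<open>F i * t \<le> i + 1 < (F i + 1) * t\<close> places \<open>q + 1\<close> and
  \<open>q + 2\<close> between the same consecutive multiples of \<open>t + 1\<close>;
  \<open>q + 3\<close> reaches the next multiple exactly if \<open>F\<close> increases.\<close>

lemma char_word_run_one:
  assumes "t > 1"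
  shows "is_image (char_word (1 / (t + 1))) (run 1) (char_word (1 / t))"
proof -
  let ?\<delta> = "1 / (t + 1)"
  define F where "F i = \<lfloor>real (i + 1) / t\<rfloor>" for i :: nat
  have F0: "F i \<ge> 0" for i
    using assms by (simp add: F_def)
  have F: "F i * t \<le> real i + 1" "real i + 1 < F i * t + t" for i
    using assms floor_divide_lower[of t "real (i + 1)"] floor_divide_upper[of t "real (i + 1)"]
    unfolding F_def by (simp_all only: distrib_right mult_1 of_nat_add of_nat_1)
  have c: "char_word (1 / t) i = (if F (Suc i) = F i then La else Lb)" for i
    by (simp add: char_word_def F_def add.commute)
  have step: "F (Suc i) = F i \<or> F (Suc i) = F i + 1" for i
  proof -
    have "real_of_int (F (Suc i)) * t < (real_of_int (F i) + 2) * t"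
      using F(1)[of "Suc i"] F(2)[of i] assms by (simp add: distrib_right)
    then have "real_of_int (F (Suc i)) < real_of_int (F i) + 2"
      using assms by simp
    then have "F (Suc i) < F i + 2"
      by linarith
    moreover have "F i \<le> F (Suc i)"
      unfolding F_def using assms by (intro floor_mono divide_right_mono) auto
    ultimately show ?thesis
      by linarith
  qed
  have s: "int (start (run 1) (char_word (1 / t)) i) = int i + F i" for i
  proof (induction i)
    case 0
    then show ?case
      using assms by (simp add: F_def floor_eq_iff)
  next
    case (Suc i)
    then show ?case
      using step[of i] by (auto simp: c)
  qed
  have fl: "\<lfloor>r * ?\<delta>\<rfloor> = m" if "m * t + m \<le> r" "r < m * t + t + (m + 1)"
    for r :: real and m :: int
  proof -
    have "m \<le> r / (t + 1)" "r / (t + 1) < m + 1"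
      using that assms by (simp_all add: pos_le_divide_eq pos_divide_less_eq algebra_simps)
    then show ?thesis
      by (simp add: floor_eq_iff)
  qed
  show ?thesis
    unfolding is_image_def
  proof
    fix i
    define q where "q = start (run 1) (char_word (1 / t)) i"
    have q: "real q = i + F i"
      using arg_cong[OF s[of i], of real_of_int] by (simp add: q_def)
    have 1: "\<lfloor>real (q + 1) * ?\<delta>\<rfloor> = F i"
      using F[of i] q assms by (intro fl) linarith+
    have 2: "\<lfloor>real (q + 2) * ?\<delta>\<rfloor> = F i"
      using F[of i] q assms by (intro fl) linarith+
    have a: "char_word ?\<delta> q = La"
      using 1 2 unfolding char_word_def by simp
    have "char_word ?\<delta> (Suc q) = Lb" if "F (Suc i) = F i + 1"
    proof -
      have "real_of_int (F (Suc i)) * t = real_of_int (F i) * t + t"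
        unfolding that by (simp add: distrib_right)
      moreover have "real_of_int (F i + 1) * t = real_of_int (F i) * t + t"
        by (simp add: distrib_right)
      ultimately have "\<lfloor>real (q + 3) * ?\<delta>\<rfloor> = F i + 1"
        using F[of i] F(1)[of "Suc i"] q assms by (intro fl) linarith+
      then show ?thesis
        using 2 unfolding char_word_def by (simp add: numeral_eq_Suc)
    qed
    with a step[of i] show "occurs_at (char_word ?\<delta>) (run 1 (char_word (1 / t) i)) q"
      by (auto simp: c occurs_at_Cons)
  qed
qed

lemma is_image_id: "is_image c (run 0) c"
proof -
  have "run 0 x = [x]" for x
    by (cases x) auto
  moreover from this have "start (run 0) c i = i" for i
    by (induction i) auto
  ultimately show ?thesis
    by (simp add: is_image_def occurs_at_Cons)
qed

lemma char_word_run: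
  assumes "t > 1"
  shows "is_image (char_word (1 / (t + real m))) (run m) (char_word (1 / t))"
proof (induction m)
  case 0
  then show ?case
    by (simp add: is_image_id)
next
  case (Suc m)
  have "is_image (char_word (1 / (t + real m + 1))) (run 1) (char_word (1 / (t + real m)))"
    using assms by (intro char_word_run_one) simp
  from is_image_comp[OF this Suc]
  have "is_image (char_word (1 / (t + real m + 1))) (\<lambda>x. morph (run 1) (run m x))
    (char_word (1 / t))" .
  moreover have "morph (run 1) (run m x) = run (Suc m) x" for x
    by (cases x) (auto simp: morph_replicate_eq replicate_app_Cons_same)
  ultimately show ?case
    by (simp add: algebra_simps)
qed

section \<open>Exchange of letters and removal of the first partial quotient\<close>

fun other :: "letter \<Rightarrow> letter" where
  "other La = Lb"
| "other Lb = La"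

text \<open>No positive multiple of an irrational \<gamma> is an integer, so the floors of
  \<open>m * (1 - \<gamma>)\<close> and \<open>m * \<gamma>\<close> add up to \<open>m - 1\<close>;
  the increments for the two slopes are therefore complementary.\<close>

lemma char_word_one_minus:
  assumes "\<gamma> \<notin> \<rat>" "0 < \<gamma>" "\<gamma> < 1"
  shows "char_word (1 - \<gamma>) n = other (char_word \<gamma> n)"
proof -
  have fl: "\<lfloor>real (Suc m) * (1 - \<gamma>)\<rfloor> = int m - \<lfloor>real (Suc m) * \<gamma>\<rfloor>" for m
  proof -
    have "real (Suc m) * \<gamma> \<notin> \<rat>"
    proof
      assume "real (Suc m) * \<gamma> \<in> \<rat>"
      then have "real (Suc m) * \<gamma> / real (Suc m) \<in> \<rat>"
        by (intro Rats_divide) auto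
      with assms show False
        by simp
    qed
    then have "real_of_int \<lfloor>real (Suc m) * \<gamma>\<rfloor> \<noteq> real (Suc m) * \<gamma>"
      by (metis Rats_of_int)
    then have "real_of_int \<lfloor>real (Suc m) * \<gamma>\<rfloor> < real (Suc m) * \<gamma>"
      using of_int_floor_le[of "real (Suc m) * \<gamma>"] by linarith
    moreover have "real (Suc m) * (1 - \<gamma>) = real (Suc m) - real (Suc m) * \<gamma>"
      by (simp add: right_diff_distrib)
    ultimately show ?thesis
      using real_of_int_floor_add_one_ge[of "real (Suc m) * \<gamma>"]
      by (intro floor_unique; simp only: of_int_diff of_int_of_nat_eq of_nat_Suc; linarith)
  qed
  have "\<lfloor>real (n + 2) * (1 - \<gamma>)\<rfloor> - \<lfloor>real (n + 1) * (1 - \<gamma>)\<rfloor>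
      = 1 - (\<lfloor>real (n + 2) * \<gamma>\<rfloor> - \<lfloor>real (n + 1) * \<gamma>\<rfloor>)"
    using fl[of n] fl[of "Suc n"] by simp
  moreover have "\<lfloor>real (n + 2) * \<gamma>\<rfloor> - \<lfloor>real (n + 1) * \<gamma>\<rfloor> = 0 \<or>
    \<lfloor>real (n + 2) * \<gamma>\<rfloor> - \<lfloor>real (n + 1) * \<gamma>\<rfloor> = 1"
  proof -
    have "real (n + 2) * \<gamma> = real (n + 1) * \<gamma> + \<gamma>"
      by (simp add: algebra_simps)
    with assms show ?thesis
      by linarith
  qed
  ultimately show ?thesis
    by (auto simp: char_word_def)
qed

text \<open>This is the standard morphism with \<open>a\<close> going to \<open>a^m b\<close> and
  \<open>b\<close> to \<open>a\<close>; written through \<open>other\<close>, it inherits the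
  results on \<open>run\<close>.\<close>

abbreviation sigma :: "nat \<Rightarrow> letter \<Rightarrow> letter list" where
  "sigma m x \<equiv> run m (other x)"

lemma other_other [simp]: "other (other x) = x"
  by (cases x) auto

lemma occurs_at_other: "occurs_at (\<lambda>i. other (c i)) w j \<longleftrightarrow> occurs_at c (map other w) j"
  by (induction w arbitrary: j) (auto simp: occurs_at_Cons)

lemma start_other: "start (sigma m) c i = start (run m) (\<lambda>i. other (c i)) i"
  by (induction i) auto

lemma is_image_other: "is_image c (sigma m) c' \<longleftrightarrow> is_image c (run m) (\<lambda>i. other (c' i))"
  by (simp add: is_image_def start_other)

lemma sigma_starts:
  "is_image c (sigma m) c' \<Longrightarrow> occurs_at c (replicate m La) (start (sigma m) c' i)"
  unfolding is_image_other start_other by (rule run_starts)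

lemma occurs_sigma_iff:
  assumes "is_image c (sigma m) c'"
  shows "occurs_at c (morph (sigma m) w @ replicate m La) q \<longleftrightarrow>
    (\<exists>j. q = start (sigma m) c' j \<and> occurs_at c' w j)"
  using occurs_run_iff[of c m "\<lambda>i. other (c' i)" "map other w" q] assms
  by (simp add: is_image_other start_other occurs_at_other comp_def)

lemma occurs_sigma_Lb_iff:
  assumes "is_image c (sigma m) c'" and "w = [] \<or> last w = La"
  shows "occurs_at c (Lb # morph (sigma m) w) q \<longleftrightarrow>
    (\<exists>j. q = start (sigma m) c' j + m \<and> occurs_at c' (La # w) j)"
proof -
  have "map other w = [] \<or> last (map other w) = Lb"
    using assms(2) by (cases w rule: rev_cases) auto
  then show ?thesis
    using occurs_run_Lb_iff[of c m "\<lambda>i. other (c' i)" "map other w" q] assms(1)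
      occurs_at_other[of c' "Lb # map other w"]
    by (simp add: is_image_other start_other comp_def)
qed

text \<open>Lowering the first partial quotient by \<open>d 1\<close> leaves the slope
  \<open>1 / (1 + \<xi>)\<close>, which is 1 minus the slope of the shifted sequence. Passing to the
  latter exchanges the letters and turns \<open>run\<close> into \<open>sigma\<close>.\<close>

lemma quotients_desubstitution:
  fixes d :: "nat \<Rightarrow> nat"
  assumes d: "\<And>i. i \<ge> 1 \<Longrightarrow> d i \<ge> 1" and irr: "cf_value (quotients d) \<notin> \<rat>"
  defines "d' \<equiv> \<lambda>i. d (Suc i)"
  shows "is_image (char_word (cf_value (quotients d))) (sigma (d 1))
    (char_word (cf_value (quotients d')))"
    and "cf_value (quotients d') \<notin> \<rat>"
proof -
  define \<xi> where "\<xi> = cf_value (\<lambda>i. int (d (Suc i)))"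
  define \<xi>' where "\<xi>' = cf_value (\<lambda>i. int (d' (Suc i)))"
  have d': "d' i \<ge> 1" if "i \<ge> 1" for i
    using d[of "Suc i"] by (simp add: d'_def)
  have v: "cf_value (quotients d) = 1 / (1 + real (d 1) + \<xi>)" "0 < \<xi>"
    unfolding \<xi>_def using d by (rule quotients_value; simp)+
  have v': "cf_value (quotients d') = 1 / (1 + real (d' 1) + \<xi>')" "0 < \<xi>'"
    unfolding \<xi>'_def using d' by (rule quotients_value; simp)+
  have "\<xi> = 1 / (real (d' 1) + \<xi>')"
    unfolding \<xi>_def \<xi>'_def d'_def[symmetric]
    by (subst cf_value_rec) (use d in \<open>simp_all add: d'_def\<close>)
  then have flip: "cf_value (quotients d') = 1 - 1 / (1 + \<xi>)"
    using v(2) v'(2) by (simp add: v'(1) field_simps)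
  have "\<xi> \<notin> \<rat>"
    using irr unfolding v(1) by auto
  then have irr': "1 / (1 + \<xi>) \<notin> \<rat>"
  proof (rule contrapos_nn)
    assume "1 / (1 + \<xi>) \<in> \<rat>"
    then have "1 / (1 / (1 + \<xi>)) - 1 \<in> \<rat>"
      by (metis Rats_1 Rats_diff Rats_divide)
    then show "\<xi> \<in> \<rat>"
      by simp
  qed
  show "cf_value (quotients d') \<notin> \<rat>"
  proof
    assume "cf_value (quotients d') \<in> \<rat>"
    then have "1 - cf_value (quotients d') \<in> \<rat>"
      by (intro Rats_diff) auto
    with irr' flip show False
      by simp
  qed
  have "is_image (char_word (1 / (1 + \<xi> + real (d 1)))) (run (d 1)) (char_word (1 / (1 + \<xi>)))"
    using v(2) by (intro char_word_run) simp
  moreover have "char_word (1 / (1 + \<xi>)) i = other (char_word (cf_value (quotients d')) i)" for i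
    unfolding flip using v(2) irr' by (simp add: char_word_one_minus)
  then have "char_word (1 / (1 + \<xi>)) = (\<lambda>i. other (char_word (cf_value (quotients d')) i))"
    by blast
  ultimately show "is_image (char_word (cf_value (quotients d))) (sigma (d 1))
    (char_word (cf_value (quotients d')))"
    by (simp add: is_image_other v(1) ac_simps)
qed

text \<open>The word of level \<open>n\<close> has first quotient \<open>1 + d (Suc n)\<close>,
  whereas \<alpha> itself has \<open>d (Suc n)\<close> at this place unless \<open>n = 0\<close>;
  this offset is the case distinction in \<kappa>. The bound on \<open>m\<close> keeps the lowered
  entry of the directive sequence positive.\<close>

lemma cf_shift_image:
  fixes d :: "nat \<Rightarrow> nat"
  assumes d: "\<And>i. i \<ge> 1 \<Longrightarrow> d i \<ge> 1" and m: "m < d (Suc n)"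
    and \<kappa>: "\<kappa> = (if n = 0 then 0 else 1) - int m"
  shows "is_image (char_word (cf_value (quotients (\<lambda>i. d (i + n))))) (run m)
    (char_word (cf_shift (quotients d) n \<kappa>))"
proof -
  let ?e = "\<lambda>i. d (i + n)" and ?f = "\<lambda>i. if i = 1 then d (Suc n) - m else d (i + n)"
  define \<xi> where "\<xi> = cf_value (\<lambda>i. int (d (Suc i + n)))"
  have e: "?e i \<ge> 1" "?f i \<ge> 1" if "i \<ge> 1" for i
    using d[of "i + n"] that m by auto
  have v: "cf_value (quotients ?e) = 1 / (1 + real (d (Suc n)) + \<xi>)" "0 < \<xi>"
    using quotients_value[of ?e] e by (simp_all add: \<xi>_def)
  have "cf_value (\<lambda>i. int (?f (Suc i))) = \<xi>"
    unfolding \<xi>_def by (rule cf_value_cong) simp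
  then have "cf_value (quotients ?f) = 1 / (1 + real (d (Suc n) - m) + \<xi>)"
    using quotients_value(1)[of ?f] e by simp
  moreover have "cf_shift (quotients d) n \<kappa> = cf_value (quotients ?f)"
    unfolding cf_shift_def
    by (rule cf_value_cong) (use m in \<open>auto simp: quotients_def \<kappa> of_nat_diff add.commute\<close>)
  moreover have "is_image (char_word (1 / (1 + real (d (Suc n) - m) + \<xi> + real m))) (run m)
    (char_word (1 / (1 + real (d (Suc n) - m) + \<xi>)))"
    using v(2) by (intro char_word_run) simp
  ultimately show ?thesis
    using m by (simp add: v(1) of_nat_diff algebra_simps)
qed

section \<open>Standard words and desubstitution\<close>

text \<open>\<open>stdm d n\<close> maps \<open>a\<close> to \<open>s\<^sub>n\<close> and \<open>b\<close> to \<open>s\<^sub>n\<^sub>-\<^sub>1\<close>.\<close>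

fun stdm :: "(nat \<Rightarrow> nat) \<Rightarrow> nat \<Rightarrow> letter \<Rightarrow> letter list" where
  "stdm d 0 x = [x]"
| "stdm d (Suc n) x = morph (stdm d n) (sigma (d (Suc n)) x)"

declare stdm.simps [simp del]

lemma stdm_0: "stdm d 0 = (\<lambda>x. [x])"
  by (simp add: stdm.simps fun_eq_iff)

lemma stdm_Suc: "stdm d (Suc n) = (\<lambda>x. morph (stdm d n) (sigma (d (Suc n)) x))"
  by (simp add: stdm.simps fun_eq_iff)

lemma stdm_nonempty [simp]: "stdm d n x \<noteq> []"
proof (induction n arbitrary: x)
  case (Suc n)
  then show ?case
    by (cases x) (auto simp: stdm_Suc)
qed (simp add: stdm_0)

lemma stdm_Suc_La: "stdm d (Suc n) La = concat (replicate (d (Suc n)) (stdm d n La)) @ stdm d n Lb"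
  by (simp add: stdm_Suc)

lemma stdm_Suc_Lb: "stdm d (Suc n) Lb = stdm d n La"
  by (simp add: stdm_Suc)

lemma last_stdm: "last (stdm d n La) = (if odd n then Lb else La)"
    "last (stdm d n Lb) = (if odd n then La else Lb)"
  by (induction n) (auto simp: stdm_0 stdm_Suc_La stdm_Suc_Lb)

lemma morph_stdm_Suc: "morph (stdm d (Suc n)) w = morph (stdm d n) (morph (sigma (d (Suc n))) w)"
  by (simp add: morph_morph stdm_Suc)

lemma length_concat_replicate [simp]: "length (concat (replicate k s)) = k * length s"
  by (induction k) auto

text \<open>This is the central word, \<open>s_n s_(n-1)\<close> without its last two letters. It
  can be read at every block start, whatever blocks follow.\<close>

fun overhang :: "(nat \<Rightarrow> nat) \<Rightarrow> nat \<Rightarrow> letter list" where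
  "overhang d 0 = []"
| "overhang d (Suc n) = morph (stdm d n) (replicate (d (Suc n)) La) @ overhang d n"

lemma length_overhang: "length (overhang d n) + 2 = length (stdm d n La) + length (stdm d n Lb)"
  by (induction n) (auto simp: stdm_0 stdm_Suc_La stdm_Suc_Lb)

text \<open>\<open>c n\<close> stands for the word left after \<open>n\<close> desubstitutions. The
  combinatorics of occurrences is developed from this tower alone; slopes return in
  \<open>directive_char_word\<close>.\<close>

locale directive =
  fixes d :: "nat \<Rightarrow> nat" and c :: "nat \<Rightarrow> nat \<Rightarrow> letter"
  assumes d_pos: "\<And>i. i \<ge> 1 \<Longrightarrow> d i \<ge> 1"
    and desubst: "\<And>n. is_image (c n) (sigma (d (Suc n))) (c (Suc n))"
begin

lemma start_stdm_Suc:
  "start (stdm d (Suc n)) (c (Suc n)) i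
    = start (stdm d n) (c n) (start (sigma (d (Suc n))) (c (Suc n)) i)"
  unfolding stdm_Suc by (rule start_comp[OF desubst])

lemma start_stdm_0: "start (stdm d 0) (c 0) i = i"
  by (induction i) (auto simp: stdm_0)

lemma image_stdm: "is_image (c 0) (stdm d n) (c n)"
proof (induction n)
  case 0
  show ?case
    by (simp add: is_image_def occurs_at_Cons start_stdm_0) (simp add: stdm_0 occurs_at_Cons)
next
  case (Suc n)
  show ?case
    unfolding stdm_Suc by (rule is_image_comp[OF Suc desubst])
qed

text \<open>A core of level \<open>n + 1\<close> is a core of level \<open>n\<close> with the two
  letters exchanged. For \<open>x = a\<close> the new inner word is the image of \<open>w\<close>
  under \<open>sigma\<close>; for \<open>x = b\<close> it is that image followed by \<open>a\<close>
  to the power \<open>d (Suc n)\<close>, split off from the truncated \<open>s_(n+1)\<close>. The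
  two recognisability lemmas for \<open>sigma\<close> match these cases.\<close>

lemma occurs_core_iff:
  assumes "w = [] \<or> last w = x"
  shows "occurs_at (c 0) (last (stdm d n x) # morph (stdm d n) w @ butlast (stdm d n (other x))) q \<longleftrightarrow>
    (\<exists>j. q = start (stdm d n) (c n) j + (length (stdm d n x) - 1) \<and> occurs_at (c n) (x # w) j)"
  using assms
proof (induction n arbitrary: w x q)
  case 0
  have "morph (stdm d 0) w = w"
    by (induction w) (auto simp: stdm_0)
  moreover have "last (stdm d 0 x) = x" "butlast (stdm d 0 (other x)) = []" "length (stdm d 0 x) = 1"
    by (simp_all add: stdm_0)
  ultimately show ?case
    by (simp add: start_stdm_0)
next
  case (Suc n)
  let ?e = "d (Suc n)"
  let ?\<sigma> = "sigma ?e" and ?s = "start (stdm d n) (c n)"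
  let ?t = "start ?\<sigma> (c (Suc n))"
  have e: "?e > 0"
    using d_pos[of "Suc n"] by simp
  show ?case
  proof (cases x)
    case La
    have w': "morph ?\<sigma> w = [] \<or> last (morph ?\<sigma> w) = Lb"
      using Suc.prems La by (cases w rule: rev_cases) auto
    \<comment> \<open>The \<open>b\<close> that ends the block sits \<open>?e\<close> letters after
      its start, and these letters are all \<open>a\<close>, each with an image of length
      \<open>|s_n|\<close>.\<close>
    have len: "?s (?t j + ?e) = start (stdm d (Suc n)) (c (Suc n)) j + ?e * length (stdm d n La)"
      for j
      using image_occurs(2)[OF image_stdm sigma_starts[OF desubst, of n j]]
      by (simp add: start_stdm_Suc)
    have len': "length (stdm d (Suc n) La) - 1
        = ?e * length (stdm d n La) + (length (stdm d n Lb) - 1)"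
      by (cases "stdm d n Lb") (simp_all add: stdm_Suc_La)
    have eq: "last (stdm d (Suc n) La) # morph (stdm d (Suc n)) w
          @ butlast (stdm d (Suc n) (other La))
        = last (stdm d n Lb) # morph (stdm d n) (morph ?\<sigma> w) @ butlast (stdm d n (other Lb))"
      unfolding morph_stdm_Suc stdm_Suc_La stdm_Suc_Lb other.simps by simp
    have "(\<exists>j. q = ?s j + l \<and> (\<exists>i. j = ?t i + ?e \<and> occurs_at (c (Suc n)) (La # w) i)) \<longleftrightarrow>
        (\<exists>i. q = ?s (?t i + ?e) + l \<and> occurs_at (c (Suc n)) (La # w) i)" for l
      by blast
    then show ?thesis
      unfolding La eq Suc.IH[OF w'] occurs_sigma_Lb_iff[OF desubst Suc.prems[unfolded La]] len' len
      by (simp only: add.assoc)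
  next
    case Lb
    let ?w = "morph ?\<sigma> w @ replicate ?e La"
    have w': "?w = [] \<or> last ?w = La"
      using e by simp
    have eq: "last (stdm d (Suc n) Lb) # morph (stdm d (Suc n)) w
          @ butlast (stdm d (Suc n) (other Lb))
        = last (stdm d n La) # morph (stdm d n) ?w @ butlast (stdm d n (other La))"
      unfolding morph_stdm_Suc stdm_Suc_La stdm_Suc_Lb other.simps by (simp add: butlast_append)
    have iff: "occurs_at (c n) (La # ?w) j \<longleftrightarrow>
        (\<exists>i. j = ?t i \<and> occurs_at (c (Suc n)) (Lb # w) i)" for j
      using occurs_sigma_iff[OF desubst, of n "Lb # w" j] by simp
    show ?thesis
      unfolding Lb eq Suc.IH[OF w'] iff unfolding start_stdm_Suc stdm_Suc_Lb by blast
  qed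
qed

lemma occurs_overhang: "occurs_at (c 0) (overhang d n) (start (stdm d n) (c n) j)"
proof (induction n arbitrary: j)
  case (Suc n)
  let ?e = "d (Suc n)"
  let ?j = "start (sigma ?e) (c (Suc n)) j"
  have r: "occurs_at (c n) (replicate ?e La) ?j"
    by (rule sigma_starts[OF desubst])
  show ?case
    using image_occurs[OF image_stdm r] Suc.IH[of "?j + ?e"]
    by (simp add: occurs_at_append start_stdm_Suc)
qed simp

text \<open>Behind the core of \<open>u\<close> the word \<open>r\<close> can only be read inside the overhang, which follows
  every block; so one occurrence of \<open>u\<close> suffices to extend all occurrences of its core.\<close>

lemma occurs_extended_core_iff:
  assumes w: "w = [] \<or> last w = La"
    and P: "butlast (stdm d n La) = P @ v"
    and u: "u = v @ (last (stdm d n La) # morph (stdm d n) w @ butlast (stdm d n Lb)) @ r"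
    and r: "length r < length (stdm d n La)"
    and fac: "is_factor u (c 0)"
  shows "occurs_at (c 0) u q \<longleftrightarrow>
    (\<exists>j. q = start (stdm d n) (c n) j + length P \<and> occurs_at (c n) (La # w) j)"
proof -
  define x where "x = last (stdm d n La)"
  let ?b = "butlast (stdm d n Lb)" and ?s = "start (stdm d n) (c n)"
  let ?core = "x # morph (stdm d n) w @ ?b"
  have SLa: "stdm d n La = P @ v @ [x]"
    using append_butlast_last_id[of "stdm d n La"] by (simp add: P x_def)
  note u = u[folded x_def]
  have lenP: "length (stdm d n La) - 1 = length P + length v"
    by (subst SLa) simp
  have core: "\<exists>j. p = ?s j + length P \<and> occurs_at (c n) (La # w) j" if "occurs_at (c 0) u p" for p
  proof -
    have "occurs_at (c 0) ?core (p + length v)"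
      using that unfolding u occurs_at_append by blast
    then have "occurs_at (c 0) (x # morph (stdm d n) w @ butlast (stdm d n (other La)))
        (p + length v)"
      by simp
    then show ?thesis
      unfolding x_def occurs_core_iff[OF w] lenP by auto
  qed
  have after: "?s (j + length (La # w))
      = ?s j + length P + length v + 1 + length (morph (stdm d n) w)"
    if "occurs_at (c n) (La # w) j" for j
    using image_occurs(2)[OF image_stdm that] by (simp add: SLa)
  obtain p where p: "occurs_at (c 0) u p"
    using fac by (auto simp: is_factor_def)
  then obtain i where i: "p = ?s i + length P" "occurs_at (c n) (La # w) i"
    using core by blast
  have "occurs_at (c 0) (?b @ r) (?s (i + length (La # w)))"
    using p unfolding u after[OF i(2)] i(1)
    by (simp add: occurs_at_append occurs_at_Cons add.assoc)
  \<comment> \<open>The bound is tight: \<open>|s_(n-1)| - 1\<close> plus at most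
    \<open>|s_n| - 1\<close> is the length of the overhang.\<close>
  moreover have "length (?b @ r) \<le> length (overhang d n)"
    using r length_overhang[of d n] by (cases "stdm d n Lb" rule: rev_cases) auto
  ultimately obtain z where z: "overhang d n = (?b @ r) @ z"
    using occurs_at_prefix occurs_overhang by blast
  show ?thesis
  proof
    assume "\<exists>j. q = ?s j + length P \<and> occurs_at (c n) (La # w) j"
    then obtain j where j: "q = ?s j + length P" "occurs_at (c n) (La # w) j"
      by blast
    \<comment> \<open>On the left \<open>v\<close> lies inside the first block
      \<open>s_n = P v x\<close>; on the right \<open>r\<close> lies inside the overhang.\<close>
    have "occurs_at (c 0) (morph (stdm d n) (La # w)) (?s j)"
      by (rule image_occurs(1)[OF image_stdm j(2)])
    then have "occurs_at (c 0) (P @ v @ [x] @ morph (stdm d n) w) (?s j)"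
      using SLa by simp
    moreover have "occurs_at (c 0) (?b @ r) (?s (j + length (La # w)))"
      using occurs_overhang[of n "j + length (La # w)"] unfolding z occurs_at_append by blast
    ultimately show "occurs_at (c 0) u q"
      unfolding u after[OF j(2)] j(1)
      by (simp add: occurs_at_append occurs_at_Cons add.assoc)
  qed (rule core)
qed

end

section \<open>Decompositions in the free group\<close>

lemma freegroup_right_inverse: "x * inverse x = (1 :: 'a freegroup)"
proof -
  have "x * inverse x = inverse (inverse x) * inverse x * (x * inverse x)"
    by (simp add: freegroup_left_inverse)
  also have "\<dots> = inverse (inverse x) * (inverse x * x) * inverse x"
    by (simp only: mult.assoc)
  also have "\<dots> = 1"
    by (simp add: freegroup_left_inverse)
  finally show ?thesis .
qed

interpretation freegroup: group "(*)" "1 :: 'a freegroup" inverse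
  by unfold_locales (simp_all add: freegroup_left_inverse)

lemma freegroup_cancel [simp]:
  fixes x y :: "'a freegroup"
  shows "inverse x * x = 1" "x * inverse x = 1"
    "inverse x * (x * y) = y" "x * (inverse x * y) = y"
  by (simp_all add: freegroup_left_inverse freegroup_right_inverse flip: mult.assoc)

lemma power_mult_left_commute: "x ^ k * (x * y) = x * (x ^ k * (y :: 'a :: monoid_mult))"
  by (simp add: power_commutes flip: mult.assoc)

lemma freegroup_inverse_power_left_commute:
  "x * (inverse (x ^ k) * y) = inverse (x ^ k) * (x * (y :: 'a freegroup))"
proof -
  have "x * inverse (x ^ k) = inverse (x ^ k) * (x ^ k * x) * inverse (x ^ k)"
    by (simp add: mult.assoc)
  also have "\<dots> = inverse (x ^ k) * x"
    unfolding power_commutes by (simp add: mult.assoc)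
  finally show ?thesis
    by (simp flip: mult.assoc)
qed

lemma freegroup_conjugate_power: "(x * y * inverse x) ^ k = x * y ^ k * inverse (x :: 'a freegroup)"
  by (induction k) (simp_all add: mult.assoc)

lemma word_Nil [simp]: "word [] = 1"
  by transfer simp

lemma word_append: "word (xs @ ys) = word xs * word ys"
proof (transfer fixing: xs ys)
  have "reduced (map (Pair True) (xs @ ys))"
    using word.rep_eq[of "xs @ ys"] Rep_freegroup[of "word (xs @ ys)"] by simp
  then show "map (Pair True) (xs @ ys) = reduce (map (Pair True) xs @ map (Pair True) ys)"
    by (simp add: reduce_id)
qed

lemma word_Cons: "word (x # xs) = word [x] * word xs"
  using word_append[of "[x]" xs] by simp

lemma word_concat_replicate: "word (concat (replicate k xs)) = word xs ^ k"
  by (induction k) (simp_all add: word_append)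

lemma word_replicate: "word (replicate k x) = word [x] ^ k"
  using word_concat_replicate[of k "[x]"] by simp

lemma word_butlast: "xs \<noteq> [] \<Longrightarrow> word (butlast xs) = word xs * inverse (word [last xs])"
  by (cases xs rule: rev_cases) (simp_all add: word_append mult.assoc)

text \<open>By the two equations \<open>P\<close> moves rightwards through the product and turns
  each \<open>u z_j\<close> into the block of \<open>c' j\<close>. What remains is a full prefix of
  blocks followed by \<open>P\<close>, and \<open>P\<close> is read at every block start.\<close>

lemma decomposition_image:
  assumes img: "is_image c h c'" and ne: "\<And>x. h x \<noteq> []"
    and occ: "\<And>q. occurs_at c u q \<longleftrightarrow> (\<exists>i. q = start h c' i + length P)"
    and pre: "\<And>i. occurs_at c P (start h c' i)"
    and z: "word P * (word u * x) = word (h La) * word P"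
      "word P * (word u * y) = word (h Lb) * word P"
  shows "decomposition c (word P) u (subst_word c' x y)"
  unfolding decomposition_def
proof (intro exI conjI allI)
  let ?p = "\<lambda>i. start h c' i + length P"
  show "strict_mono ?p"
    using start_strict_mono[of h c', OF ne] by (simp add: strict_mono_def)
  show "range ?p = {q. occurs_at c u q}"
    by (auto simp: occ)
  fix i
  let ?z = "\<lambda>j. word u * subst_word c' x y j"
  have step: "word P * ?z j = word (h (c' j)) * word P" for j
    by (cases "c' j") (simp_all add: subst_word_def z)
  have "word P * prod_list (map ?z [0..<i]) = word (morph h (map c' [0..<i])) * word P"
  proof (induction i)
    case (Suc i)
    have "word P * prod_list (map ?z [0..<Suc i]) = word P * prod_list (map ?z [0..<i]) * ?z i"
      by (simp add: mult.assoc)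
    also have "\<dots> = word (morph h (map c' [0..<i])) * (word P * ?z i)"
      by (simp only: Suc.IH mult.assoc)
    finally show ?case
      by (simp add: step word_append mult.assoc)
  qed simp
  also have "\<dots> = word (map c [0..<start h c' i]) * word (map c [start h c' i..<?p i])"
    using pre[of i] by (simp add: image_prefix[OF img] occurs_at_def)
  also have "\<dots> = word (map c [0..<?p i])"
    by (simp only: upt_add_eq_append[OF le0] map_append word_append)
  finally show "word P * prod_list (map ?z [0..<i]) = word (map c [0..<?p i])" .
qed

section \<open>Closed forms of singular and adjoining words\<close>

context
  fixes d :: "nat \<Rightarrow> nat"
  assumes d_pos: "\<And>i. i \<ge> 1 \<Longrightarrow> d i \<ge> 1"
begin

text \<open>\<open>A n\<close>, \<open>B n\<close> are \<open>s\<^sub>n\<close>, \<open>s\<^sub>n\<^sub>-\<^sub>1\<close>, and \<open>X n\<close>, \<open>Y n\<close> are their last letters.\<close>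

private abbreviation "A n \<equiv> word (stdm d n La)"
private abbreviation "B n \<equiv> word (stdm d n Lb)"
private abbreviation "X n \<equiv> word [last (stdm d n La)]"
private abbreviation "Y n \<equiv> word [last (stdm d n Lb)]"

lemma std_from_eq: "std_from d n = B n" "std_from d (Suc n) = A n"
proof (induction n)
  case (Suc n)
  {
    case 1
    show ?case
      by (simp add: Suc stdm_Suc_Lb)
  next
    case 2
    show ?case
      by (simp add: Suc stdm_Suc_La word_append word_concat_replicate)
  }
qed (simp_all add: stdm_0)

lemma sing_eq: "sing d (int n) = Y n * A n * inverse (X n)"
  using std_from_eq(2)[of n] by (simp add: sing_def std_def last_stdm nat_add_distrib)

lemma sing_minus_one_eq: "sing d (int n - 1) = X n * B n * inverse (Y n)"
proof (cases n)
  case 0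
  then show ?thesis
    by (simp add: sing_def stdm_0 mult.assoc)
next
  case (Suc m)
  then show ?thesis
    using sing_eq[of m] by (simp add: stdm_Suc_Lb last_stdm)
qed

text \<open>Cancelling one factor \<open>s_(n-1)\<close> from
  \<open>s_n = s_(n-1)^(d n) s_(n-2)\<close> yields the exponent \<open>d n - 1\<close> of the
  definition; parity only selects the letters.\<close>

lemma adj_eq: "adj d (int n - 2) = Y n * inverse (B n) * A n * inverse (X n)"
proof (cases n)
  case 0
  then show ?thesis
    by (simp add: adj_def stdm_0)
next
  case (Suc m)
  obtain e where e: "d (Suc m) = Suc e"
    using d_pos[of "Suc m"] by (cases "d (Suc m)") auto
  have "std d (int n - 1) = A m" "std d (int n - 2) = B m" "nat (int n) = Suc m"
    using std_from_eq[of m] Suc by (simp_all add: std_def nat_add_distrib)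
  then show ?thesis
    using Suc e
    by (auto simp: adj_def stdm_Suc_La stdm_Suc_Lb last_stdm word_append
        word_concat_replicate mult.assoc)
qed

text \<open>The product telescopes: the letter \<open>Y (Suc n)\<close> and the word
  \<open>B (Suc n)\<close> in the next factor are \<open>X n\<close> and \<open>A n\<close>.\<close>

lemma prod_adj_eq: "prod_list (map (adj d) [-1..int n - 2]) = word (butlast (stdm d n La))"
proof (induction n)
  case (Suc n)
  have "[-1..int (Suc n) - 2] = [-1..int n - 2] @ [int (Suc n) - 2]"
    by (subst upto_rec2) simp_all
  then have "prod_list (map (adj d) [-1..int (Suc n) - 2])
      = word (butlast (stdm d n La)) * adj d (int (Suc n) - 2)"
    by (simp only: map_append prod_list.append Suc.IH) simp
  then show ?case
    unfolding adj_eq by (simp add: word_butlast stdm_Suc_Lb mult.assoc)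
qed (simp add: stdm_0)

text \<open>The repeated factor \<open>w_(n-1) v_(n-2)\<close> is \<open>s_n\<close> conjugated by
  its last letter, so its powers are conjugates of powers of \<open>s_n\<close>.\<close>

lemma Uw_eq: "Uw d n (int k) = X n * A n ^ k * B n * inverse (Y n)"
proof -
  have "sing d (int n - 1) * adj d (int n - 2) = X n * A n * inverse (X n)"
    unfolding adj_eq sing_minus_one_eq by (simp add: mult.assoc)
  then have "Uw d n (int k) = (X n * A n * inverse (X n)) ^ k * sing d (int n - 1)"
    by (simp add: Uw_def)
  then show ?thesis
    unfolding freegroup_conjugate_power sing_minus_one_eq by (simp add: mult.assoc)
qed

lemma Ubarw_eq: "Ubarw d n (int k) = Y n * inverse (B n) * A n ^ Suc k * inverse (X n)"
proof -
  have "adj d (int n - 2) * sing d (int n - 1)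
      = Y n * inverse (B n) * A n * inverse (Y n * inverse (B n))"
    unfolding adj_eq sing_minus_one_eq
    by (simp add: freegroup.inverse_distrib_swap mult.assoc)
  then have "Ubarw d n (int k)
      = (Y n * inverse (B n) * A n * inverse (Y n * inverse (B n))) ^ k * adj d (int n - 2)"
    by (simp add: Ubarw_def)
  then show ?thesis
    unfolding freegroup_conjugate_power adj_eq power_Suc2
    by (simp add: freegroup.inverse_distrib_swap mult.assoc)
qed

text \<open>The convention for index -1 is the value of the closed form there, so one formula serves
  \<open>k = 0\<close> as well.\<close>

lemma inverse_Uw_pred:
  "inverse (Uw d n (int k - 1)) = Y n * inverse (B n) * A n * inverse (A n ^ k) * inverse (X n)"
proof (cases k)
  case 0
  then show ?thesis
    by (simp add: Uw_def adj_eq)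
next
  case (Suc j)
  have "inverse (A n ^ j) = A n * inverse (A n ^ Suc j)"
    unfolding power_Suc2 by (simp add: freegroup.inverse_distrib_swap)
  then show ?thesis
    using Suc Uw_eq[of n j] by (simp add: freegroup.inverse_distrib_swap mult.assoc)
qed

lemma inverse_Ubarw_pred:
  "inverse (Ubarw d n (int k - 1)) = X n * inverse (A n ^ k) * B n * inverse (Y n)"
proof (cases k)
  case 0
  then show ?thesis
    by (simp add: Ubarw_def sing_minus_one_eq)
next
  case (Suc j)
  then show ?thesis
    using Ubarw_eq[of n j] by (simp add: freegroup.inverse_distrib_swap mult.assoc)
qed

section \<open>Assembly of the decompositions\<close>

context
  assumes irrational: "cf_value (quotients d) \<notin> \<rat>"
begin

private abbreviation "cw n \<equiv> char_word (cf_value (quotients (\<lambda>i. d (i + n))))"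

lemma directive_char_word: "directive d (\<lambda>n. cw n)"
proof
  have irr: "cf_value (quotients (\<lambda>i. d (i + n))) \<notin> \<rat>" for n
  proof (induction n)
    case (Suc n)
    show ?case
      using quotients_desubstitution(2)[of "\<lambda>i. d (i + n)"] Suc d_pos by simp
  qed (simp add: irrational)
  show "is_image (cw n) (sigma (d (Suc n))) (cw (Suc n))" for n
    using quotients_desubstitution(1)[of "\<lambda>i. d (i + n)"] irr[of n] d_pos by simp
qed (rule d_pos)

interpretation directive d "\<lambda>n. cw n"
  by (rule directive_char_word)

lemma word_prefix:
  assumes "butlast (stdm d n La) = P @ v"
  shows "word P = A n * inverse (X n) * inverse (word v)"
proof -
  have "word P * word v = A n * inverse (X n)"
    by (simp add: word_butlast flip: assms word_append)
  then have "word P * word v * inverse (word v) = A n * inverse (X n) * inverse (word v)"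
    by simp
  then show ?thesis
    by (simp add: mult.assoc)
qed

text \<open>Both families fit this frame: \<open>g\<close> cuts the word of level \<open>n\<close>
  exactly at the occurrences of \<open>a w\<close>, and composing with \<open>stdm d n\<close> cuts
  the whole word so that \<open>u\<close> occurs once per block, at offset
  \<open>|P|\<close>.\<close>

lemma decomposition_core:
  assumes img: "is_image (cw n) g c'" and ne: "\<And>x. g x \<noteq> []"
    and w: "w = [] \<or> last w = La"
    and occ: "\<And>j. occurs_at (cw n) (La # w) j \<longleftrightarrow> (\<exists>i. j = start g c' i)"
    and P: "butlast (stdm d n La) = P @ v"
    and u: "word u
      = word v * (X n * word (morph (stdm d n) w) * B n * inverse (Y n)) * word (rev v)"
    and fac: "is_factor u (cw 0)"
    and z: "word P * (word u * x) = word (morph (stdm d n) (g La)) * word P"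
      "word P * (word u * y) = word (morph (stdm d n) (g Lb)) * word P"
  shows "decomposition (cw 0) (word P) u (subst_word c' x y)"
proof (rule decomposition_image)
  let ?h = "\<lambda>x. morph (stdm d n) (g x)"
  have start_h: "start ?h c' i = start (stdm d n) (cw n) (start g c' i)" for i
    by (rule start_comp[OF img])
  show "is_image (cw 0) ?h c'"
    by (rule is_image_comp[OF image_stdm img])
  show "?h x \<noteq> []" for x
    using ne[of x] by (cases "g x") auto
  \<comment> \<open>The only inverse letter trims the end of \<open>s_(n-1)\<close>, so both sides
    are images of words and injectivity of \<open>word\<close> applies.\<close>
  have "word u
      = word (v @ (last (stdm d n La) # morph (stdm d n) w @ butlast (stdm d n Lb)) @ rev v)"
    unfolding u word_append word_Cons[of _ "_ @ _"] by (simp add: word_butlast mult.assoc)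
  then have u': "u = v @ (last (stdm d n La) # morph (stdm d n) w @ butlast (stdm d n Lb)) @ rev v"
    by (simp only: word_inj)
  have "length (rev v) < length (stdm d n La)"
    using arg_cong[OF P, of length] by (cases "stdm d n La" rule: rev_cases) auto
  from occurs_extended_core_iff[OF w P u' this] fac
  have iff: "occurs_at (cw 0) u q \<longleftrightarrow>
      (\<exists>j. q = start (stdm d n) (cw n) j + length P \<and> occurs_at (cw n) (La # w) j)" for q
    by simp
  show "occurs_at (cw 0) u q \<longleftrightarrow> (\<exists>i. q = start ?h c' i + length P)" for q
    unfolding iff occ start_h by blast
  show "occurs_at (cw 0) P (start ?h c' i)" for i
  proof -
    \<comment> \<open>Every block of \<open>g\<close> begins with \<open>a\<close>, so its image
      begins with \<open>s_n\<close>, of which \<open>P\<close> is a prefix.\<close>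
    have "cw n (start g c' i) = La"
      using occ[of "start g c' i"] by (auto simp: occurs_at_Cons)
    then have "occurs_at (cw 0) (stdm d n La) (start ?h c' i)"
      using image_stdm[of n] unfolding is_image_def start_h by metis
    then show ?thesis
      using append_butlast_last_id[of "stdm d n La"] P
      by (metis stdm_nonempty append_assoc occurs_at_append)
  qed
qed (fact z)+

lemma decomposition_Uw:
  assumes n: "n \<ge> 1" and k: "Suc k < d (Suc n)"
    and v: "proper_suffix_of v (adj d (int n - 2))"
    and u: "word u = word v * Uw d n (int k) * word (rev v)"
    and fac: "is_factor u (cw 0)"
  shows "decomposition (cw 0) (prod_list (map (adj d) [-1..int n - 2]) * inverse (word v)) u
    (subst_word (char_word (cf_shift (quotients d) n (- int k)))
      (inverse (word v * Uw d n (int k - 1) * word (rev v)))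
      (inverse (word (rev v)) * sing d (int n) * inverse (word v)))"
proof -
  let ?w = "replicate k La" and ?c = "char_word (cf_shift (quotients d) n (- int k))"
  \<comment> \<open>For \<open>n \<ge> 1\<close> the shift is
    \<open>1 - (k + 1) = - k\<close>.\<close>
  have img: "is_image (cw n) (run (Suc k)) ?c"
    by (rule cf_shift_image) (use d_pos k n in auto)
  obtain y where y: "adj d (int n - 2) = word y" "strict_suffix v y"
    using v by (auto simp: proper_suffix_of_def)
  \<comment> \<open>The adjoining word \<open>y\<close> is thus a suffix of \<open>s_n\<close>
    without its last letter, and so is \<open>v\<close>.\<close>
  have "word (butlast (stdm d n Lb) @ y) = word (butlast (stdm d n La))"
    by (simp add: word_append word_butlast adj_eq mult.assoc flip: y(1))
  then have "butlast (stdm d n La) = butlast (stdm d n Lb) @ y"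
    by (simp only: word_inj)
  then obtain P where P: "butlast (stdm d n La) = P @ v"
    using y(2) by (metis append_assoc strict_suffix_def suffix_def)
  have "decomposition (cw 0) (word P) u (subst_word ?c
      (inverse (word v * Uw d n (int k - 1) * word (rev v)))
      (inverse (word (rev v)) * sing d (int n) * inverse (word v)))"
  proof (rule decomposition_core[OF img _ _ _ P _ fac])
    show "?w = [] \<or> last ?w = La"
      by (cases k) auto
    show "occurs_at (cw n) (La # ?w) j \<longleftrightarrow> (\<exists>i. j = start (run (Suc k)) ?c i)" for j
      using occurs_run_power_iff[OF img, of j] by simp
    show "word u = word v * (X n * word (morph (stdm d n) ?w) * B n * inverse (Y n)) * word (rev v)"
      by (simp add: u Uw_eq word_concat_replicate)
    show "word P * (word u * inverse (word v * Uw d n (int k - 1) * word (rev v)))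
        = word (morph (stdm d n) (run (Suc k) La)) * word P"
      unfolding u word_prefix[OF P] freegroup.inverse_distrib_swap inverse_Uw_pred Uw_eq
      by (simp add: power_mult_left_commute mult.assoc)
    show "word P * (word u * (inverse (word (rev v)) * sing d (int n) * inverse (word v)))
        = word (morph (stdm d n) (run (Suc k) Lb)) * word P"
      unfolding u word_prefix[OF P] sing_eq Uw_eq
      by (simp add: word_append word_concat_replicate mult.assoc)
  qed simp
  moreover have "word P = prod_list (map (adj d) [-1..int n - 2]) * inverse (word v)"
    unfolding prod_adj_eq word_prefix[OF P] by (simp add: word_butlast)
  ultimately show ?thesis
    by simp
qed

lemma decomposition_Ubarw:
  assumes n: "n \<ge> 1" and k: "k < d (Suc n)"
    and v: "proper_suffix_of v (sing d (int n - 1))"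
    and u: "word u = word v * Ubarw d n (int k) * word (rev v)"
    and fac: "is_factor u (cw 0)"
  shows "decomposition (cw 0) (prod_list (map (adj d) [-1..int n - 3]) * inverse (word v)) u
    (subst_word (char_word (cf_shift (quotients d) n (1 - int k)))
      (inverse (word v * Ubarw d n (int k - 1) * word (rev v)))
      (inverse (word v * Uw d (n - 1) (int (d n) - 2) * word (rev v))))"
proof -
  obtain m where m: "n = Suc m"
    using n by (cases n) auto
  obtain e where e: "d n = Suc e"
    using d_pos[OF n] by (cases "d n") auto
  let ?c = "char_word (cf_shift (quotients d) n (1 - int k))"
  let ?g = "\<lambda>x. morph (sigma (d n)) (run k x)"
  have img: "is_image (cw n) (run k) ?c"
    by (rule cf_shift_image) (use d_pos k n in auto)
  have desubst': "is_image (cw m) (sigma (d n)) (cw n)"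
    using desubst[of m] unfolding m .
  have img': "is_image (cw m) ?g ?c"
    by (rule is_image_comp[OF desubst' img])
  \<comment> \<open>The core begins with a separate letter \<open>a\<close>, here the first letter
    of the image; it exists since \<open>d n\<close> is positive.\<close>
  let ?w = "tl (morph (sigma (d n)) (replicate k La) @ replicate (d n) La)"
  have w: "La # ?w = morph (sigma (d n)) (replicate k La) @ replicate (d n) La"
    by (cases k) (simp_all add: e)
  have S: "stdm d n La = concat (replicate (d n) (stdm d m La)) @ stdm d m Lb"
    "stdm d n Lb = stdm d m La"
    unfolding m by (rule stdm_Suc_La, rule stdm_Suc_Lb)
  have A_n: "A n = B n ^ d n * B m"
    by (simp add: S word_append word_concat_replicate)
  have X_n: "X n = Y m" and Y_n: "Y n = X m"
    by (simp_all add: S)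
  have morph_w: "word (morph (stdm d m) ?w) = inverse (B n) * A n ^ k * B n ^ d n"
  proof -
    have "morph (stdm d m) (morph (sigma (d n)) (replicate k La))
        = concat (replicate k (stdm d n La))"
      using morph_stdm_Suc[of d m "replicate k La"] unfolding m by simp
    then have "morph (stdm d m) (La # ?w)
        = concat (replicate k (stdm d n La)) @ concat (replicate (d n) (stdm d n Lb))"
      unfolding w by (simp add: S(2))
    then have "word (morph (stdm d m) (La # ?w))
        = word (concat (replicate k (stdm d n La)) @ concat (replicate (d n) (stdm d n Lb)))"
      by (rule arg_cong)
    then have "B n * word (morph (stdm d m) ?w) = A n ^ k * B n ^ d n"
      by (simp add: S(2) word_append word_concat_replicate)
    then show ?thesis
      by (metis freegroup_cancel(3) mult.assoc)
  qed
  obtain y where y: "sing d (int n - 1) = word y" "strict_suffix v y"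
    using v by (auto simp: proper_suffix_of_def)
  \<comment> \<open>The singular word exceeds the truncated \<open>s_m\<close> by one letter in
    front, so a proper suffix of it is a suffix of the truncated \<open>s_m\<close>.\<close>
  have "word (last (stdm d n La) # butlast (stdm d m La)) = word y"
    by (simp add: word_Cons[of _ "butlast _"] word_butlast sing_minus_one_eq S(2) mult.assoc
        flip: y(1))
  then have "y = last (stdm d n La) # butlast (stdm d m La)"
    by (simp only: word_inj)
  moreover obtain zs where zs: "y = zs @ v" "zs \<noteq> []"
    using y(2) by (auto simp: strict_suffix_def suffix_def)
  ultimately have "butlast (stdm d m La) = tl zs @ v"
    by (cases zs) simp_all
  then obtain P where P: "butlast (stdm d m La) = P @ v"
    by blast
  have word_P: "word P = B n * inverse (Y n) * inverse (word v)"
    unfolding word_prefix[OF P] by (simp add: S(2))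
  have U_m: "inverse (Uw d m (int (d n) - 2)) = X n * inverse (A n) * B n * B n * inverse (Y n)"
  proof -
    \<comment> \<open>Since \<open>d n - 2\<close> is -1 when \<open>d n = 1\<close>, it is written
      as a predecessor, where the closed form covers \<open>e = 0\<close>.\<close>
    have "int (d n) - 2 = int e - 1"
      by (simp add: e)
    then have "inverse (Uw d m (int (d n) - 2))
        = X n * inverse (B m) * B n * inverse (B n ^ e) * inverse (Y n)"
      by (simp only: inverse_Uw_pred X_n S(2))
    also have "\<dots> = X n * inverse (A n) * B n * B n * inverse (Y n)"
      unfolding A_n e power_Suc
      by (simp add: freegroup.inverse_distrib_swap freegroup_inverse_power_left_commute mult.assoc)
    finally show ?thesis .
  qed
  have "decomposition (cw 0) (word P) u (subst_word ?c
      (inverse (word v * Ubarw d n (int k - 1) * word (rev v)))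
      (inverse (word v * Uw d m (int (d n) - 2) * word (rev v))))"
  proof (rule decomposition_core[OF img' _ _ _ P _ fac])
    show "?g x \<noteq> []" for x
      by (cases x) auto
    have "last (La # ?w) = La"
      unfolding w by (simp add: e)
    then show "?w = [] \<or> last ?w = La"
      by (cases "?w = []") (simp_all del: tl_append)
    show "occurs_at (cw m) (La # ?w) j \<longleftrightarrow> (\<exists>i. j = start ?g ?c i)" for j
      unfolding w occurs_sigma_iff[OF desubst'] occurs_run_power_iff[OF img] start_comp[OF img]
      by blast
    show "word u = word v * (X m * word (morph (stdm d m) ?w) * B m * inverse (Y m)) * word (rev v)"
      unfolding u Ubarw_eq morph_w power_Suc2 A_n by (simp add: X_n Y_n mult.assoc)
    show "word P * (word u * inverse (word v * Ubarw d n (int k - 1) * word (rev v)))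
        = word (morph (stdm d m) (?g La)) * word P"
      unfolding u word_P freegroup.inverse_distrib_swap inverse_Ubarw_pred Ubarw_eq
      using morph_stdm_Suc[of d m "[La]"] m by (simp add: mult.assoc)
    have g_Lb: "morph (stdm d m) (?g Lb) = concat (replicate k (stdm d n La)) @ stdm d n Lb"
      using morph_stdm_Suc[of d m "run k Lb"] unfolding m by simp
    show "word P * (word u * inverse (word v * Uw d m (int (d n) - 2) * word (rev v)))
        = word (morph (stdm d m) (?g Lb)) * word P"
      unfolding u word_P freegroup.inverse_distrib_swap U_m Ubarw_eq g_Lb power_Suc2
      by (simp add: word_append word_concat_replicate mult.assoc)
  qed
  \<comment> \<open>The prefix belongs to level \<open>m = n - 1\<close>, so the product ends at
    \<open>m - 2 = n - 3\<close>.\<close>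
  moreover have "word P = prod_list (map (adj d) [-1..int n - 3]) * inverse (word v)"
    using prod_adj_eq[of m] unfolding word_prefix[OF P] by (simp add: m word_butlast)
  ultimately show ?thesis
    by (simp add: m)
qed

lemma decomposition_power:
  assumes "k < d 1" "k > 0"
  shows "decomposition (cw 0) 1 (replicate k La)
    (subst_word (char_word (cf_shift (quotients d) 0 (- int k))) (inverse (ga ^ (k - 1))) gb)"
proof -
  let ?c = "char_word (cf_shift (quotients d) 0 (- int k))"
  \<comment> \<open>At level 0 the first partial quotient already contains the extra 1, so lowering
    by \<open>k\<close> is the shift \<open>- k\<close>.\<close>
  have img: "is_image (cw 0) (run k) ?c"
    by (rule cf_shift_image) (use d_pos assms in auto)
  have "decomposition (cw 0) (word []) (replicate k La)
    (subst_word ?c (inverse (ga ^ (k - 1))) gb)"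
  proof (rule decomposition_image[OF img])
    obtain j where "k = Suc j"
      using assms(2) by (cases k) auto
    then show "word [] * (word (replicate k La) * inverse (ga ^ (k - 1)))
        = word (run k La) * word []"
      by (simp add: word_replicate mult.assoc del: replicate_Suc)
    show "word [] * (word (replicate k La) * gb) = word (run k Lb) * word []"
      by (simp add: word_append)
    show "occurs_at (cw 0) (replicate k La) q \<longleftrightarrow> (\<exists>i. q = start (run k) ?c i + length [])" for q
      using occurs_run_power_iff[OF img, of q] by simp
  qed simp_all
  then show ?thesis
    by simp
qed

end

end

theorem theorem5p1:
  fixes d :: "nat \<Rightarrow> nat" and \<alpha> :: real and u :: "letter list"
  assumes d_pos: "\<And>i. i \<ge> 1 \<Longrightarrow> d i \<ge> 1"
    and alpha: "\<alpha> = cf_value (quotients d)"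
    and irrational: "\<alpha> \<notin> \<rat>"
    and pal: "palindrome u"
    and len: "length u \<ge> 2"
    and fac: "is_factor u (char_word \<alpha>)"
  shows "(\<forall>(n :: nat) (k :: int) (v :: letter list).
      n \<ge> 1 \<and> 0 \<le> k \<and> k \<le> int (d (n + 1)) - 2 \<and>
      proper_suffix_of v (adj d (int n - 2)) \<and>
      word u = word v * Uw d n k * word (rev v) \<longrightarrow>
      decomposition (char_word \<alpha>)
        (prod_list (map (adj d) [-1..int n - 2]) * inverse (word v)) u
        (subst_word (char_word (cf_shift (quotients d) n (- k)))
          (inverse (word v * Uw d n (k - 1) * word (rev v)))
          (inverse (word (rev v)) * sing d (int n) * inverse (word v))))
    \<and> (\<forall>(n :: nat) (k :: int) (v :: letter list).
      n \<ge> 1 \<and> 0 \<le> k \<and> k \<le> int (d (n + 1)) - 1 \<and>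
      proper_suffix_of v (sing d (int n - 1)) \<and>
      word u = word v * Ubarw d n k * word (rev v) \<longrightarrow>
      decomposition (char_word \<alpha>)
        (prod_list (map (adj d) [-1..int n - 3]) * inverse (word v)) u
        (subst_word (char_word (cf_shift (quotients d) n (1 - k)))
          (inverse (word v * Ubarw d n (k - 1) * word (rev v)))
          (inverse (word v * Uw d (n - 1) (int (d n) - 2) * word (rev v)))))
    \<and> (\<forall>k :: nat. 2 \<le> k \<and> k \<le> d 1 - 1 \<and> u = replicate k La \<longrightarrow>
      decomposition (char_word \<alpha>) 1 u
        (subst_word (char_word (cf_shift (quotients d) 0 (- int k)))
          (inverse (ga ^ (k - 1))) gb))"
proof (intro conjI allI impI)
  have \<alpha>: "char_word \<alpha> = char_word (cf_value (quotients (\<lambda>i. d (i + 0))))"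
    by (simp add: alpha)
  note fac' = fac[unfolded \<alpha>]
  have irr: "cf_value (quotients d) \<notin> \<rat>"
    using irrational alpha by simp
  {
    fix n :: nat and k :: int and v :: "letter list"
    assume *: "n \<ge> 1 \<and> 0 \<le> k \<and> k \<le> int (d (n + 1)) - 2 \<and>
      proper_suffix_of v (adj d (int n - 2)) \<and>
      word u = word v * Uw d n k * word (rev v)"
    then obtain j where j: "k = int j"
      using nonneg_int_cases by blast
    show "decomposition (char_word \<alpha>)
        (prod_list (map (adj d) [-1..int n - 2]) * inverse (word v)) u
        (subst_word (char_word (cf_shift (quotients d) n (- k)))
          (inverse (word v * Uw d n (k - 1) * word (rev v)))
          (inverse (word (rev v)) * sing d (int n) * inverse (word v)))"
      unfolding \<alpha> j by (rule decomposition_Uw) (use * j d_pos irr fac' in auto)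
  next
    fix n :: nat and k :: int and v :: "letter list"
    assume *: "n \<ge> 1 \<and> 0 \<le> k \<and> k \<le> int (d (n + 1)) - 1 \<and>
      proper_suffix_of v (sing d (int n - 1)) \<and>
      word u = word v * Ubarw d n k * word (rev v)"
    then obtain j where j: "k = int j"
      using nonneg_int_cases by blast
    show "decomposition (char_word \<alpha>)
        (prod_list (map (adj d) [-1..int n - 3]) * inverse (word v)) u
        (subst_word (char_word (cf_shift (quotients d) n (1 - k)))
          (inverse (word v * Ubarw d n (k - 1) * word (rev v)))
          (inverse (word v * Uw d (n - 1) (int (d n) - 2) * word (rev v))))"
      unfolding \<alpha> j by (rule decomposition_Ubarw) (use * j d_pos irr fac' in auto)
  next
    fix k :: nat
    assume "2 \<le> k \<and> k \<le> d 1 - 1 \<and> u = replicate k La"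
    then show "decomposition (char_word \<alpha>) 1 u
        (subst_word (char_word (cf_shift (quotients d) 0 (- int k)))
          (inverse (ga ^ (k - 1))) gb)"
      unfolding \<alpha> using decomposition_power[of d k] d_pos irr by auto
  }
qed

end
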